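(* Let $r\ge1$ and let $(X,\sigma_X,\varphi)$ be a sofic shift-reversal system of order $2r$. Then there are a positive integer $n$ and square matrices $A_k$ and $J_k$, $k=1,2,\dots,n$, whose entries are integers (with $A_k$ and $J_k$ of the same size for each $k$, and none of $n$, $A_k$, $J_k$ depending on $m$ or $l$), such that $$f_{\sigma_X,\varphi}(m,2l)=\sum_{k=1}^{n}(-1)^{k+1}\operatorname{tr}\big((A_k)^m(J_k)^{2l}\big)\qquad\text{for all integers } m\ge 1 \text{ and } 0\le l<r.$$
   Context: A shift space is a closed shift-invariant subset $X$ of $\mathcal{A}^{\mathbb{Z}}$, where $\mathcal{A}$ is a finite set with the discrete topology and $\mathcal{A}^{\mathbb{Z}}$ has the product topology; $\sigma_X$ is the restriction to $X$ of the shift map $\sigma(x)_i=x_{i+1}$. A reversal for $(X,\sigma_X)$ is a homeomorphism $\varphi:X\to X$ with $\sigma_X\circ\varphi=\varphi\circ\sigma_X^{-1}$; the reversal system $(X,\sigma_X,\varphi)$ has order $2r$ if $2r$ is the least positive integer $n$ with $\varphi^n=\mathrm{id}_X$. It is called a sofic shift-reversal system if $(X,\sigma_X)$ is a sofic shift. For integers $m\ge1$ and $0\le l<r$, $$f_{\sigma_X,\varphi}(m,2l)=|\{x\in X: (\sigma_X)^m\circ\varphi^{2l}(x)=x\}|.$$ *)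

theory Defs
  imports
    "HOL-Analysis.Function_Topology"
    "Jordan_Normal_Form.Matrix"
begin

definition config_topology :: "'a set \<Rightarrow> (int \<Rightarrow> 'a) topology" where
  "config_topology A = product_topology (\<lambda>_. discrete_topology A) UNIV"

definition shift :: "(int \<Rightarrow> 'a) \<Rightarrow> int \<Rightarrow> 'a" where
  "shift x = (\<lambda>i. x (i + 1))"

text \<open>Shift-invariance is \<open>\<sigma>(X) = X\<close>, so that the restriction of the shift to \<open>X\<close> is invertible.\<close>

definition shift_space :: "'a set \<Rightarrow> (int \<Rightarrow> 'a) set \<Rightarrow> bool" where
  "shift_space A X \<longleftrightarrow> finite A \<and> closedin (config_topology A) X \<and> shift ` X = X"

abbreviation shift_topology :: "'a set \<Rightarrow> (int \<Rightarrow> 'a) set \<Rightarrow> (int \<Rightarrow> 'a) topology" where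
  "shift_topology A X \<equiv> subtopology (config_topology A) X"

definition occurs_in :: "'a list \<Rightarrow> (int \<Rightarrow> 'a) \<Rightarrow> bool" where
  "occurs_in w x \<longleftrightarrow> (\<exists>i. \<forall>j < length w. x (i + int j) = w ! j)"

definition shift_of_finite_type :: "'a set \<Rightarrow> (int \<Rightarrow> 'a) set \<Rightarrow> bool" where
  "shift_of_finite_type A X \<longleftrightarrow>
     finite A \<and>
     (\<exists>F. finite F \<and> F \<subseteq> lists A \<and>
        X = {x \<in> topspace (config_topology A). \<forall>w \<in> F. \<not> occurs_in w x})"

definition factor_map ::
    "'b set \<Rightarrow> (int \<Rightarrow> 'b) set \<Rightarrow> 'a set \<Rightarrow> (int \<Rightarrow> 'a) set \<Rightarrow> ((int \<Rightarrow> 'b) \<Rightarrow> (int \<Rightarrow> 'a)) \<Rightarrow> bool" where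
  "factor_map B Y A X g \<longleftrightarrow>
     continuous_map (shift_topology B Y) (shift_topology A X) g \<and>
     g ` Y = X \<and> (\<forall>y \<in> Y. g (shift y) = shift (g y))"

text \<open>A sofic shift is a factor of a shift of finite type. Since a finite alphabet can be renamed
  into the natural numbers, it suffices to let the alphabet of the cover range over
  finite sets of naturals; this avoids quantifying over types.\<close>

definition sofic_shift :: "'a set \<Rightarrow> (int \<Rightarrow> 'a) set \<Rightarrow> bool" where
  "sofic_shift A X \<longleftrightarrow>
     shift_space A X \<and>
     (\<exists>(B :: nat set) Y g. shift_of_finite_type B Y \<and> factor_map B Y A X g)"

text \<open>The map \<open>\<phi>\<close> is a total function whose values outside \<open>X\<close> are irrelevant. As \<open>shift\<close> is
  injective, \<open>inv_into X shift\<close> is the inverse of its restriction to a shift space \<open>X\<close>.\<close>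

definition reversal :: "'a set \<Rightarrow> (int \<Rightarrow> 'a) set \<Rightarrow> ((int \<Rightarrow> 'a) \<Rightarrow> (int \<Rightarrow> 'a)) \<Rightarrow> bool" where
  "reversal A X \<phi> \<longleftrightarrow>
     homeomorphic_map (shift_topology A X) (shift_topology A X) \<phi> \<and>
     (\<forall>x \<in> X. shift (\<phi> x) = \<phi> (inv_into X shift x))"

definition has_order :: "'b set \<Rightarrow> ('b \<Rightarrow> 'b) \<Rightarrow> nat \<Rightarrow> bool" where
  "has_order X \<phi> N \<longleftrightarrow>
     0 < N \<and> (\<forall>x \<in> X. (\<phi> ^^ N) x = x) \<and>
     (\<forall>n. 0 < n \<and> n < N \<longrightarrow> \<not> (\<forall>x \<in> X. (\<phi> ^^ n) x = x))"

definition sofic_shift_reversal_system ::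
    "'a set \<Rightarrow> (int \<Rightarrow> 'a) set \<Rightarrow> ((int \<Rightarrow> 'a) \<Rightarrow> (int \<Rightarrow> 'a)) \<Rightarrow> bool" where
  "sofic_shift_reversal_system A X \<phi> \<longleftrightarrow> sofic_shift A X \<and> reversal A X \<phi>"

definition fixed_points ::
    "(int \<Rightarrow> 'a) set \<Rightarrow> ((int \<Rightarrow> 'a) \<Rightarrow> (int \<Rightarrow> 'a)) \<Rightarrow> nat \<Rightarrow> nat \<Rightarrow> (int \<Rightarrow> 'a) set" where
  "fixed_points X \<phi> m j = {x \<in> X. (shift ^^ m) ((\<phi> ^^ j) x) = x}"

definition trace_mat :: "'a :: comm_monoid_add mat \<Rightarrow> 'a" where
  "trace_mat A = (\<Sum>i < dim_row A. A $$ (i, i))"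

end

theory Submission
  imports Defs
begin

text \<open>
  The square \<open>\<psi> = \<phi>\<^sup>2\<close> of the reversal commutes with the shift and has finite order, so after recording
  the whole \<open>\<psi>\<close>-orbit of a point in each letter, \<open>\<psi>\<close> acts on points letter by letter, as a rotation
  \<open>\<tau>\<close>. A point fixed by \<open>\<sigma>\<^sup>m \<psi>\<^sup>l\<close> is then a bi-infinite concatenation of the \<open>\<tau>\<^sup>l\<close>-twists of one word
  \<open>w\<close> of length \<open>m\<close>. Follower sets are the states of a finite deterministic automaton on which \<open>\<tau>\<close> acts
  as well, and \<open>w\<close> gives a point of \<open>X\<close> iff the partial map ``read \<open>w\<close>, then apply \<open>\<tau>\<^sup>l\<close>'' on states has
  a cycle. For a partial map \<open>f\<close> of a finite set, the alternating sum of the traces of the exterior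
  powers \<open>\<Lambda>\<^sup>k f\<close>, \<open>k \<ge> 1\<close>, equals \<open>1 - det (1 - f)\<close>, which is 1 if \<open>f\<close> has a cycle and 0 otherwise.
  As exterior powers are multiplicative, summing over \<open>w\<close> yields powers of two fixed matrices, one
  collecting the odd and one the even \<open>k\<close>.
\<close>

subsection \<open>Signs of injections and invariant sets\<close>

text \<open>For finite \<open>S\<close> and injective numberings this is the sign of the bijection
  from \<open>S\<close> to its image, both listed in increasing order, and 0 if \<open>f\<close>
  identifies two points of \<open>S\<close>. It is the minor that forms an entry of an exterior
  power.\<close>

definition pair_sign :: "('a \<Rightarrow> int) \<Rightarrow> ('b \<Rightarrow> int) \<Rightarrow> ('a \<Rightarrow> 'b) \<Rightarrow> 'a set \<Rightarrow> int" where
  "pair_sign \<kappa> \<kappa>' f S = (\<Prod>(i, j) \<in> {(i, j) \<in> S \<times> S. \<kappa> i < \<kappa> j}. sgn (\<kappa>' (f j) - \<kappa>' (f i)))"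

lemma pair_sign_nonzero:
  assumes "finite S" "inj_on f S" "inj_on \<kappa>' (f ` S)"
  shows "pair_sign \<kappa> \<kappa>' f S \<noteq> 0"
proof -
  have "finite {(i, j) \<in> S \<times> S. \<kappa> i < \<kappa> j}"
    using assms(1) by (auto intro: finite_subset[of _ "S \<times> S"])
  moreover have "\<kappa>' (f j) \<noteq> \<kappa>' (f i)" if "i \<in> S" "j \<in> S" "\<kappa> i < \<kappa> j" for i j
    using that assms by (metis imageI inj_on_def order_less_irrefl)
  ultimately show ?thesis
    unfolding pair_sign_def by (auto simp: sgn_0_0)
qed

lemma pair_sign_cong:
  assumes "\<And>x. x \<in> S \<Longrightarrow> f x = g x"
  shows "pair_sign \<kappa> \<kappa>' f S = pair_sign \<kappa> \<kappa>' g S"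
  unfolding pair_sign_def using assms by (intro prod.cong) auto

text \<open>Multiplicativity of signs. The product for \<open>g\<close> runs over pairs ordered by
  \<open>\<kappa>'\<close> after \<open>f\<close>; reordering them by \<open>\<kappa>\<close> costs
  exactly the signs of \<open>f\<close>.\<close>

lemma pair_sign_comp:
  assumes "inj_on \<kappa> S" "inj_on f S" "inj_on \<kappa>' (f ` S)"
  shows "pair_sign \<kappa> \<kappa>'' (g \<circ> f) S = pair_sign \<kappa> \<kappa>' f S * pair_sign \<kappa>' \<kappa>'' g (f ` S)"
proof -
  define T where "T = {(i, j) \<in> S \<times> S. \<kappa> i < \<kappa> j}"
  define T' where "T' = {(i, j) \<in> S \<times> S. \<kappa>' (f i) < \<kappa>' (f j)}"
  define e where "e = (\<lambda>(i, j). sgn (\<kappa>'' (g (f j)) - \<kappa>'' (g (f i))))"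
  define s where "s = (\<lambda>(i, j). sgn (\<kappa>' (f j) - \<kappa>' (f i)))"
  have img: "map_prod f f ` T' = {(i, j) \<in> f ` S \<times> f ` S. \<kappa>' i < \<kappa>' j}"
    by (auto simp: T'_def)
  have inj: "inj_on (map_prod f f) T'"
    using assms(2) by (auto simp: T'_def inj_on_def)
  have 1: "pair_sign \<kappa>' \<kappa>'' g (f ` S) = (\<Prod>t\<in>T'. e t)"
    unfolding pair_sign_def img[symmetric] prod.reindex[OF inj]
    by (intro prod.cong) (auto simp: e_def)
  have k: "\<kappa> i = \<kappa> j \<longleftrightarrow> i = j" "\<kappa>' (f i) = \<kappa>' (f j) \<longleftrightarrow> i = j" if "i \<in> S" "j \<in> S" for i j
    using that assms by (auto simp: inj_on_def)
  \<comment> \<open>A pair is swapped exactly when \<open>f\<close> reverses it, that is when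
    \<open>s\<close> is -1, and swapping negates \<open>e\<close>.\<close>
  have 2: "(\<Prod>t\<in>T'. e t) = (\<Prod>t\<in>T. e t * s t)"
    by (rule prod.reindex_bij_witness
        [where i = "\<lambda>(i, j). if \<kappa>' (f i) < \<kappa>' (f j) then (i, j) else (j, i)"
           and j = "\<lambda>(i, j). if \<kappa> i < \<kappa> j then (i, j) else (j, i)"])
      (auto simp: T_def T'_def e_def s_def not_less sgn_if k split: if_splits dest!: order_antisym)
  have 3: "s t * s t = 1" if "t \<in> T" for t
    using that k by (auto simp: T_def s_def sgn_if split: if_splits)
  have "pair_sign \<kappa> \<kappa>' f S * pair_sign \<kappa>' \<kappa>'' g (f ` S) = (\<Prod>t\<in>T. s t * (e t * s t))"
    unfolding 1 2 by (simp add: pair_sign_def T_def s_def prod.distrib)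
  also have "\<dots> = (\<Prod>t\<in>T. e t)"
    using 3 by (intro prod.cong refl) (simp add: mult.left_commute)
  finally show ?thesis
    by (simp add: pair_sign_def T_def e_def)
qed

text \<open>The rotation sends the last index to 0 and keeps the order of the others, so the
  inversions are the \<open>k - 1\<close> pairs containing the last index.\<close>

lemma pair_sign_rotation:
  "pair_sign int int (\<lambda>i. Suc i mod k) {0..<k} = (- 1) ^ (k - 1)"
proof (cases k)
  case 0
  then show ?thesis by (simp add: pair_sign_def)
next
  case (Suc n)
  define T where "T = {(i, j) \<in> {0..<Suc n} \<times> {0..<Suc n}. int i < int j}"
  define s where "s = (\<lambda>(i, j). sgn (int (Suc j mod Suc n) - int (Suc i mod Suc n)))"
  have "(\<Prod>t\<in>T. s t) = (\<Prod>t\<in>(\<lambda>i. (i, n)) ` {0..<n}. s t)"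
    by (rule prod.mono_neutral_right)
      (auto simp: T_def s_def image_iff mod_Suc split: if_splits
        intro: finite_subset[of _ "{0..<Suc n} \<times> {0..<Suc n}"])
  also have "\<dots> = (\<Prod>i\<in>{0..<n}. s (i, n))"
    by (simp add: prod.reindex inj_on_def)
  also have "\<dots> = (\<Prod>i\<in>{0..<n}. - 1)"
    by (intro prod.cong) (auto simp: s_def)
  finally show ?thesis
    using Suc by (simp add: pair_sign_def T_def s_def)
qed

text \<open>The orbit map \<open>?h\<close> conjugates the rotation of \<open>{0..<k}\<close> to
  \<open>f\<close>. Its own sign occurs on both sides and is nonzero, so it cancels.\<close>

lemma pair_sign_cycle:
  assumes "inj_on (\<lambda>i. (f ^^ i) q) {0..<k}" "(f ^^ k) q = q"
    and "inj_on \<kappa> ((\<lambda>i. (f ^^ i) q) ` {0..<k})"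
  shows "pair_sign \<kappa> \<kappa> f ((\<lambda>i. (f ^^ i) q) ` {0..<k}) = (- 1) ^ (k - 1)"
proof -
  let ?h = "\<lambda>i. (f ^^ i) q" and ?c = "\<lambda>i. Suc i mod k"
  have c: "?c ` {0..<k} = {0..<k}"
  proof
    show "{0..<k} \<subseteq> ?c ` {0..<k}"
    proof
      fix x assume x: "x \<in> {0..<k}"
      show "x \<in> ?c ` {0..<k}"
        by (rule image_eqI[of _ _ "if x = 0 then k - 1 else x - 1"]) (use x in auto)
    qed
  qed auto
  then have ic: "inj_on ?c {0..<k}"
    by (simp add: eq_card_imp_inj_on)
  have step: "(f \<circ> ?h) i = (?h \<circ> ?c) i" if "i \<in> {0..<k}" for i
  proof (cases "Suc i = k")
    case True
    then show ?thesis using assms(2) by auto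
  next
    case False
    then have "Suc i < k" using that by auto
    then show ?thesis by simp
  qed
  have "pair_sign int \<kappa> ?h {0..<k} * pair_sign \<kappa> \<kappa> f (?h ` {0..<k}) = pair_sign int \<kappa> (f \<circ> ?h) {0..<k}"
    using pair_sign_comp[OF _ assms(1,3), of int \<kappa> f] by simp
  also have "\<dots> = pair_sign int \<kappa> (?h \<circ> ?c) {0..<k}"
    using step by (rule pair_sign_cong)
  also have "\<dots> = pair_sign int int ?c {0..<k} * pair_sign int \<kappa> ?h {0..<k}"
    using pair_sign_comp[OF _ ic, of int int \<kappa> ?h] unfolding c by simp
  finally show ?thesis
    using pair_sign_nonzero[OF _ assms(1,3), of int] pair_sign_rotation[of k] by simp
qed

text \<open>Mixed pairs contribute 1 in total: \<open>f\<close> permutes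
  \<open>S \<times> C\<close>, so the product of their orientations is the same before and after
  \<open>f\<close>.\<close>

lemma pair_sign_union:
  assumes "finite S" "finite C" "S \<inter> C = {}" "f ` S = S" "f ` C = C" "inj_on \<kappa> (S \<union> C)"
  shows "pair_sign \<kappa> \<kappa> f (S \<union> C) = pair_sign \<kappa> \<kappa> f S * pair_sign \<kappa> \<kappa> f C"
proof -
  define s where "s = (\<lambda>(i, j). sgn (\<kappa> (f j) - \<kappa> (f i)))"
  define e where "e = (\<lambda>(i, j). sgn (\<kappa> j - \<kappa> i))"
  define P where "P = (\<lambda>S. {(i, j) \<in> S \<times> S. \<kappa> i < \<kappa> j})"
  define X where "X = {(i, j) \<in> S \<times> C \<union> C \<times> S. \<kappa> i < \<kappa> j}"
  have fin: "finite (P S)" "finite (P C)" "finite X"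
    using assms(1,2) unfolding P_def X_def
    by (auto intro: finite_subset[of _ "S \<times> S"] finite_subset[of _ "C \<times> C"]
        finite_subset[of _ "S \<times> C \<union> C \<times> S"])
  have split: "P (S \<union> C) = (P S \<union> P C) \<union> X"
    by (auto simp: P_def X_def)
  have k: "\<kappa> i \<noteq> \<kappa> j" if "i \<in> S" "j \<in> C" for i j
    using that assms(3,6) by (auto simp: inj_on_def)
  have fk: "\<kappa> (f i) \<noteq> \<kappa> (f j)" if "i \<in> S" "j \<in> C" for i j
    using that assms(4,5) k by blast
  have inj: "inj_on (map_prod f f) (S \<times> C)"
  proof (rule map_prod_inj_on)
    show "inj_on f S" "inj_on f C"
      using assms by (auto intro: eq_card_imp_inj_on)
  qed
  have img: "map_prod f f ` (S \<times> C) = S \<times> C"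
    using assms(4,5) by (metis map_prod_surj_on)
  have s: "(\<Prod>t\<in>S \<times> C. s t) = (\<Prod>t\<in>S \<times> C. e t)"
  proof -
    have "(\<Prod>t\<in>S \<times> C. e t) = (\<Prod>t\<in>map_prod f f ` (S \<times> C). e t)"
      using img by simp
    also have "\<dots> = (\<Prod>t\<in>S \<times> C. s t)"
      unfolding prod.reindex[OF inj] by (intro prod.cong) (auto simp: s_def e_def)
    finally show ?thesis by simp
  qed
  \<comment> \<open>On \<open>X\<close> the factor \<open>e\<close> is 1, and
    \<open>s t * e t\<close> does not change when a pair is swapped, so each mixed pair may be
    written with its component in \<open>S\<close> first.\<close>
  have "(\<Prod>t\<in>X. s t) = (\<Prod>t\<in>S \<times> C. s t * e t)"
    by (rule prod.reindex_bij_witness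
        [where i = "\<lambda>(i, j). if \<kappa> i < \<kappa> j then (i, j) else (j, i)"
           and j = "\<lambda>(i, j). if i \<in> S then (i, j) else (j, i)"])
      (use assms(3) k fk in \<open>auto simp: X_def s_def e_def sgn_if not_less split: if_splits\<close>, force+)
  also have "\<dots> = (\<Prod>t\<in>S \<times> C. e t * e t)"
    by (simp add: prod.distrib s)
  also have "\<dots> = 1"
    using k by (intro prod.neutral) (fastforce simp: e_def sgn_if)
  finally have X: "(\<Prod>t\<in>X. s t) = 1" .
  have disj: "P S \<inter> P C = {}" "(P S \<union> P C) \<inter> X = {}"
    using assms(3) by (auto simp: P_def X_def)
  have ps: "pair_sign \<kappa> \<kappa> f T = (\<Prod>t\<in>P T. s t)" for T
    by (simp add: pair_sign_def P_def s_def)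
  have "pair_sign \<kappa> \<kappa> f (S \<union> C) = (\<Prod>t\<in>P S \<union> P C. s t) * (\<Prod>t\<in>X. s t)"
    unfolding ps split using fin disj by (intro prod.union_disjoint) auto
  also have "\<dots> = (\<Prod>t\<in>P S. s t) * (\<Prod>t\<in>P C. s t)"
    using fin disj by (simp add: X prod.union_disjoint)
  finally show ?thesis
    by (simp add: ps)
qed

text \<open>A surjection of a finite set onto itself is injective, so an orbit returns to its very
  starting point. Taking the least return time makes the points of the cycle distinct.\<close>

lemma exists_cycle:
  assumes "finite C" "C \<noteq> {}" "f ` C = C"
  obtains q k where "0 < k" "q \<in> C" "(f ^^ k) q = q" "inj_on (\<lambda>i. (f ^^ i) q) {0..<k}"
proof -
  obtain q where q: "q \<in> C" using assms(2) by auto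
  have inj: "inj_on f C"
    using assms by (simp add: eq_card_imp_inj_on)
  have mem: "(f ^^ i) q \<in> C" for i
    by (induction i) (use q assms(3) in auto)
  have cancel: "(f ^^ (b - a)) q = q" if "(f ^^ a) q = (f ^^ b) q" "a \<le> b" for a b
    using that
  proof (induction a arbitrary: b)
    case (Suc a)
    then obtain c where b: "b = Suc c" by (cases b) auto
    with Suc.prems inj mem have "(f ^^ a) q = (f ^^ c) q"
      by (auto simp: inj_on_def)
    then show ?case using Suc b by auto
  qed auto
  have "\<not> inj (\<lambda>i. (f ^^ i) q)"
  proof
    assume "inj (\<lambda>i. (f ^^ i) q)"
    moreover have "finite (range (\<lambda>i. (f ^^ i) q))"
      using mem by (intro finite_subset[OF _ assms(1)]) auto
    ultimately show False using finite_imageD infinite_UNIV_nat by blast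
  qed
  then obtain a b where "a < b" "(f ^^ a) q = (f ^^ b) q"
    unfolding inj_on_def by (metis linorder_neqE_nat)
  then have ex: "\<exists>k. 0 < k \<and> (f ^^ k) q = q"
    using cancel[of a b] by (intro exI[of _ "b - a"]) auto
  define k where "k = (LEAST k. 0 < k \<and> (f ^^ k) q = q)"
  have k: "0 < k" "(f ^^ k) q = q"
    using LeastI_ex[OF ex] by (auto simp: k_def)
  have "(f ^^ a) q \<noteq> (f ^^ b) q" if "a < b" "b < k" for a b
    using that cancel[of a b] not_less_Least[of "b - a" "\<lambda>k. 0 < k \<and> (f ^^ k) q = q"]
    by (auto simp: k_def)
  then have "inj_on (\<lambda>i. (f ^^ i) q) {0..<k}"
    by (intro linorder_inj_onI) auto
  with k q show thesis by (intro that)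
qed

text \<open>The left-hand side is \<open>det (1 - f)\<close> for the matrix of \<open>f\<close> restricted to \<open>U\<close>. Adding or removing
  one fixed cycle of \<open>f\<close> is a sign-reversing involution on the invariant sets.\<close>

lemma alternating_sum_invariant_sets:
  assumes U: "finite U" "inj_on \<kappa> U"
  shows "(\<Sum>S\<in>{S. S \<subseteq> U \<and> f ` S = S}. (- 1) ^ card S * pair_sign \<kappa> \<kappa> f S) =
    (if \<exists>C. C \<noteq> {} \<and> C \<subseteq> U \<and> f ` C = C then 0 else 1)"
proof (cases "\<exists>C. C \<noteq> {} \<and> C \<subseteq> U \<and> f ` C = C")
  case False
  then have "{S. S \<subseteq> U \<and> f ` S = S} = {{}}" by auto
  with False show ?thesis by (auto simp: pair_sign_def)
next
  case True
  then obtain C where C: "C \<noteq> {}" "C \<subseteq> U" "f ` C = C" by blast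
  obtain q k where k: "0 < k" "q \<in> C" "(f ^^ k) q = q" "inj_on (\<lambda>i. (f ^^ i) q) {0..<k}"
    using exists_cycle[OF finite_subset[OF C(2) U(1)] C(1,3)] .
  define D where "D = {S. S \<subseteq> U \<and> f ` S = S}"
  define Z where "Z = (\<lambda>i. (f ^^ i) q) ` {0..<k}"
  define D0 where "D0 = {S \<in> D. S \<inter> Z = {}}"
  define t where "t = (\<lambda>S. (- 1) ^ card S * pair_sign \<kappa> \<kappa> f S)"
  have mem: "(f ^^ i) x \<in> S" if "x \<in> S" "f ` S = S" for i x S
    by (induction i) (use that in auto)
  have Z: "Z \<subseteq> U" "finite Z" "card Z = k"
    using mem[OF k(2) C(3)] C(2) k(4) by (auto simp: Z_def card_image)
  have fZ: "f ` Z = Z"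
  proof
    show "f ` Z \<subseteq> Z"
    proof clarify
      fix x assume "x \<in> Z"
      then obtain i where i: "i < k" "x = (f ^^ i) q" by (auto simp: Z_def)
      show "f x \<in> Z"
      proof (cases "Suc i = k")
        case True
        have "f x = (f ^^ 0) q"
          using k(3) True i(2) by auto
        then show ?thesis using k(1) unfolding Z_def by (intro image_eqI) auto
      next
        case False
        have "f x = (f ^^ Suc i) q" using i(2) by simp
        then show ?thesis using False i(1) unfolding Z_def by (intro image_eqI[of _ _ "Suc i"]) auto
      qed
    qed
    show "Z \<subseteq> f ` Z"
    proof clarify
      fix x assume "x \<in> Z"
      then obtain i where i: "i < k" "x = (f ^^ i) q" by (auto simp: Z_def)
      define j where "j = (if i = 0 then k - 1 else i - 1)"
      have "(f ^^ Suc j) q = x"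
      proof (cases "i = 0")
        case True
        then have "Suc j = k" using k(1) by (simp add: j_def)
        then have "(f ^^ Suc j) q = q" using k(3) by (simp only:)
        then show ?thesis using True i(2) by simp
      qed (use i in \<open>auto simp: j_def\<close>)
      then have "f ((f ^^ j) q) = x" by simp
      moreover have "(f ^^ j) q \<in> Z" using i by (auto simp: j_def Z_def)
      ultimately show "x \<in> f ` Z" by blast
    qed
  qed
  \<comment> \<open>An invariant set that meets the cycle can be followed around it and contains all
    of it. Hence every invariant set outside \<open>D0\<close> arises from one in \<open>D0\<close>
    by adding \<open>Z\<close>.\<close>
  have dich: "Z \<subseteq> S" if SD: "S \<in> D" and SZ: "S \<inter> Z \<noteq> {}" for S
  proof -
    obtain i where i: "i < k" "(f ^^ i) q \<in> S" using SZ by (auto simp: Z_def)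
    have S: "f ` S = S" using SD by (simp add: D_def)
    have "(f ^^ (k - i)) ((f ^^ i) q) \<in> S"
      using mem[OF i(2) S] .
    then have "(f ^^ (k - i + i)) q \<in> S"
      unfolding funpow_add by simp
    then have "q \<in> S"
      using i k by simp
    then show ?thesis using mem S by (auto simp: Z_def)
  qed
  have inj: "inj_on f S" if "S \<in> D" for S
    using that U(1) by (auto simp: D_def intro: eq_card_imp_inj_on dest: finite_subset)
  have D: "D = D0 \<union> (\<lambda>S. S \<union> Z) ` D0"
  proof
    show "D0 \<union> (\<lambda>S. S \<union> Z) ` D0 \<subseteq> D"
      using Z fZ by (auto simp: D0_def D_def image_Un)
    show "D \<subseteq> D0 \<union> (\<lambda>S. S \<union> Z) ` D0"
    proof
      fix S assume S: "S \<in> D"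
      show "S \<in> D0 \<union> (\<lambda>S. S \<union> Z) ` D0"
      proof (cases "S \<inter> Z = {}")
        case False
        with S dich have ZS: "Z \<subseteq> S" by auto
        have "f ` (S - Z) = S - Z"
          using inj_on_image_set_diff[OF inj[OF S], of S Z] ZS fZ S by (auto simp: D_def)
        then have "S - Z \<in> D0" using S by (auto simp: D0_def D_def)
        moreover have "S = (S - Z) \<union> Z" using ZS by auto
        ultimately show ?thesis by blast
      qed (use S in \<open>auto simp: D0_def\<close>)
    qed
  qed
  have fin: "finite D0"
    using U(1) by (auto simp: D0_def D_def intro: finite_subset[of _ "Pow U"])
  \<comment> \<open>The cardinality contributes the \<open>k\<close>-th power of -1 and the sign of
    the cycle the \<open>(k - 1)\<close>-st, so the product is -1 for either parity of
    \<open>k\<close>.\<close>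
  have pair: "t (S \<union> Z) = - t S" if S: "S \<in> D0" for S
  proof -
    have S': "finite S" "S \<inter> Z = {}" "f ` S = S" "S \<subseteq> U"
      using S U(1) by (auto simp: D0_def D_def intro: finite_subset)
    have "pair_sign \<kappa> \<kappa> f Z = (- 1) ^ (k - 1)"
      unfolding Z_def
      by (rule pair_sign_cycle[OF k(4,3)]) (use Z(1) U(2) in \<open>auto simp: Z_def intro: inj_on_subset\<close>)
    moreover have "pair_sign \<kappa> \<kappa> f (S \<union> Z) = pair_sign \<kappa> \<kappa> f S * pair_sign \<kappa> \<kappa> f Z"
      by (rule pair_sign_union) (use S' Z fZ U in \<open>auto intro: inj_on_subset\<close>)
    moreover have "(- 1 :: int) ^ k * (- 1) ^ (k - 1) = - 1"
      using k(1) by (cases k) (auto simp flip: power_mult_distrib)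
    ultimately show ?thesis
      using S' Z by (simp add: t_def card_Un_disjoint power_add mult.left_commute[of _ "pair_sign \<kappa> \<kappa> f S"])
        (simp add: mult.assoc)
  qed
  have injU: "inj_on (\<lambda>S. S \<union> Z) D0"
    by (auto simp: inj_on_def D0_def)
  have "Z \<noteq> {}" using k(1) by (auto simp: Z_def)
  then have "D0 \<inter> (\<lambda>S. S \<union> Z) ` D0 = {}"
    by (auto simp: D0_def)
  then have "(\<Sum>S\<in>D. t S) = (\<Sum>S\<in>D0. t S) + (\<Sum>S\<in>D0. t (S \<union> Z))"
    unfolding D using fin injU by (simp add: sum.union_disjoint sum.reindex)
  also have "\<dots> = 0"
    using pair by (simp add: sum_negf)
  finally show ?thesis
    using True by (simp add: D_def t_def)
qed

subsection \<open>Traces of exterior powers\<close>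

text \<open>Matrices whose rows and columns are indexed by the entries of a list: if these are
  distinct, products and traces become sums over \<open>set ss\<close>.\<close>

definition kernel_mat :: "'s list \<Rightarrow> ('s \<Rightarrow> 's \<Rightarrow> int) \<Rightarrow> int mat" where
  "kernel_mat ss a = mat (length ss) (length ss) (\<lambda>(i, j). a (ss ! i) (ss ! j))"

lemma kernel_mat_carrier [simp]: "kernel_mat ss a \<in> carrier_mat (length ss) (length ss)"
  by (simp add: kernel_mat_def)

lemma kernel_mat_cong:
  assumes "\<And>x y. x \<in> set ss \<Longrightarrow> y \<in> set ss \<Longrightarrow> a x y = b x y"
  shows "kernel_mat ss a = kernel_mat ss b"
  unfolding kernel_mat_def by (rule eq_matI) (auto simp: assms)

lemma kernel_mat_mult:
  assumes "distinct ss"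
  shows "kernel_mat ss a * kernel_mat ss b = kernel_mat ss (\<lambda>x y. \<Sum>z\<in>set ss. a x z * b z y)"
proof (rule eq_matI)
  fix i j
  assume "i < dim_row (kernel_mat ss (\<lambda>x y. \<Sum>z\<in>set ss. a x z * b z y))"
    "j < dim_col (kernel_mat ss (\<lambda>x y. \<Sum>z\<in>set ss. a x z * b z y))"
  then have ij: "i < length ss" "j < length ss" by (auto simp: kernel_mat_def)
  have bij: "bij_betw ((!) ss) {0..<length ss} (set ss)"
    using assms by (intro bij_betw_nth) auto
  show "(kernel_mat ss a * kernel_mat ss b) $$ (i, j) =
      kernel_mat ss (\<lambda>x y. \<Sum>z\<in>set ss. a x z * b z y) $$ (i, j)"
    using ij by (auto simp: kernel_mat_def scalar_prod_def sum.reindex_bij_betw[OF bij, symmetric])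
qed (auto simp: kernel_mat_def)

lemma trace_kernel_mat:
  assumes "distinct ss"
  shows "trace_mat (kernel_mat ss a) = (\<Sum>x\<in>set ss. a x x)"
proof -
  have "bij_betw ((!) ss) {..<length ss} (set ss)"
    using assms by (intro bij_betw_nth) auto
  then show ?thesis
    by (auto simp: trace_mat_def kernel_mat_def sum.reindex_bij_betw[symmetric])
qed

text \<open>In what follows partial maps are encoded as total maps fixing a sink \<open>z\<close>. For the matrix of \<open>f\<close> on \<open>U\<close>, this is the matrix of its exterior powers \<open>\<Lambda>\<^sup>k\<close> with \<open>k > 0\<close>
  of one parity, indexed by the subsets of \<open>U\<close>.\<close>

definition ext_kernel :: "('q \<Rightarrow> int) \<Rightarrow> bool \<Rightarrow> ('q \<Rightarrow> 'q) \<Rightarrow> 'q set \<Rightarrow> 'q set \<Rightarrow> int" where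
  "ext_kernel \<kappa> b f S T =
    (if S \<noteq> {} \<and> even (card S) = b \<and> f ` S = T \<and> card T = card S then pair_sign \<kappa> \<kappa> f S else 0)"

text \<open>Functoriality of exterior powers, that is Cauchy-Binet for partial maps: row
  \<open>S\<close> of \<open>f\<close> has at most one nonzero entry, in the column of the image of
  \<open>S\<close>. If \<open>f\<close> merges points of \<open>S\<close> or sends one to
  \<open>z\<close>, both sides vanish, since \<open>g z = z\<close> keeps lost points lost.\<close>

lemma ext_kernel_comp:
  assumes Q: "finite Q" "inj_on \<kappa> Q" and f: "f ` Q \<subseteq> Q" and g: "g z = z"
    and S: "S \<subseteq> Q - {z}" and T: "T \<subseteq> Q - {z}"
  shows "(\<Sum>R\<in>Pow (Q - {z}). ext_kernel \<kappa> b f S R * ext_kernel \<kappa> b g R T) = ext_kernel \<kappa> b (g \<circ> f) S T"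
proof -
  have fin: "finite S" using S Q(1) finite_subset by blast
  show ?thesis
  proof (cases "inj_on f S \<and> z \<notin> f ` S")
    case True
    then have fS: "f ` S \<in> Pow (Q - {z})" "card (f ` S) = card S"
      using S f by (auto simp: card_image)
    have "(\<Sum>R\<in>Pow (Q - {z}). ext_kernel \<kappa> b f S R * ext_kernel \<kappa> b g R T) =
        (\<Sum>R\<in>{f ` S}. ext_kernel \<kappa> b f S R * ext_kernel \<kappa> b g R T)"
      by (rule sum.mono_neutral_right) (use fS Q in \<open>auto simp: ext_kernel_def\<close>)
    moreover have "pair_sign \<kappa> \<kappa> (g \<circ> f) S = pair_sign \<kappa> \<kappa> f S * pair_sign \<kappa> \<kappa> g (f ` S)"
    proof (rule pair_sign_comp)
      show "inj_on \<kappa> S" "inj_on \<kappa> (f ` S)"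
        using Q(2) S fS(1) by (meson Diff_subset PowD inj_on_subset subset_trans)+
    qed (use True in simp)
    ultimately show ?thesis
      using fS by (auto simp: ext_kernel_def image_comp)
  next
    case False
    have "ext_kernel \<kappa> b f S R = 0" if "R \<subseteq> Q - {z}" for R
      using False that fin by (auto simp: ext_kernel_def intro: eq_card_imp_inj_on)
    moreover have "ext_kernel \<kappa> b (g \<circ> f) S T = 0"
    proof (rule ccontr)
      assume "ext_kernel \<kappa> b (g \<circ> f) S T \<noteq> 0"
      then have gf: "(g \<circ> f) ` S = T" "card T = card S"
        by (auto simp: ext_kernel_def split: if_splits)
      then have "inj_on (g \<circ> f) S"
        using fin by (auto intro: eq_card_imp_inj_on)
      then have "inj_on f S" by (rule inj_on_imageI2)
      moreover have "z \<notin> f ` S"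
        using gf(1) T g by (metis Diff_iff image_comp image_eqI insertCI subsetD)
      ultimately show False using False by simp
    qed
    ultimately show ?thesis by (simp add: sum.neutral)
  qed
qed

text \<open>The flag \<open>False\<close> selects odd cardinalities. Diagonal entries live on
  nonempty invariant sets, so the difference is the negated alternating sum without its empty-set
  term 1; this is the 1 in \<open>1 - det (1 - f)\<close>.\<close>

lemma sum_ext_kernel:
  assumes Q: "finite U" "inj_on \<kappa> U"
  shows "(\<Sum>S\<in>Pow U. ext_kernel \<kappa> False f S S) - (\<Sum>S\<in>Pow U. ext_kernel \<kappa> True f S S) =
    (if \<exists>C. C \<noteq> {} \<and> C \<subseteq> U \<and> f ` C = C then 1 else 0)"
proof -
  let ?D = "{S. S \<subseteq> U \<and> f ` S = S}"
  let ?t = "\<lambda>S. (- 1) ^ card S * pair_sign \<kappa> \<kappa> f S"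
  have finD: "finite ?D" using Q(1) by simp
  have "(\<Sum>S\<in>Pow U. ext_kernel \<kappa> False f S S) - (\<Sum>S\<in>Pow U. ext_kernel \<kappa> True f S S) =
      (\<Sum>S\<in>Pow U. ext_kernel \<kappa> False f S S - ext_kernel \<kappa> True f S S)"
    by (simp add: sum_subtractf)
  also have "\<dots> = (\<Sum>S\<in>?D - {{}}. - ?t S)"
    by (rule sum.mono_neutral_cong_right) (use Q(1) in \<open>auto simp: ext_kernel_def\<close>)
  also have "\<dots> = - ((\<Sum>S\<in>?D. ?t S) - ?t {})"
    using finD by (subst sum_diff1) (auto simp: sum_negf)
  finally show ?thesis
    unfolding alternating_sum_invariant_sets[OF Q] by (auto simp: pair_sign_def)
qed

text \<open>Only even powers of \<open>J\<close> occur, so \<open>J\<^sup>2 = diag P P\<close> suffices; no square root of \<open>P\<close> is needed.\<close>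

lemma trace_mult_block_square_root:
  fixes A P :: "int mat"
  assumes A: "A \<in> carrier_mat d d" and P: "P \<in> carrier_mat d d"
  obtains M J where "M \<in> carrier_mat (d + d) (d + d)" "J \<in> carrier_mat (d + d) (d + d)"
    "\<And>m l. m \<ge> 1 \<Longrightarrow> trace_mat (M ^\<^sub>m m * J ^\<^sub>m (2 * l)) = trace_mat (A ^\<^sub>m m * P ^\<^sub>m l)"
proof
  let ?Z = "0\<^sub>m d d :: int mat"
  \<comment> \<open>The square of \<open>?J\<close> carries \<open>P\<close> twice; the zero block
    of \<open>?M\<close> removes the second copy from the trace.\<close>
  let ?M = "four_block_mat A ?Z ?Z ?Z"
  let ?J = "four_block_mat ?Z P (1\<^sub>m d) ?Z"
  show MJ: "?M \<in> carrier_mat (d + d) (d + d)" "?J \<in> carrier_mat (d + d) (d + d)"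
    using A P by auto
  have pw: "A ^\<^sub>m k \<in> carrier_mat d d" "P ^\<^sub>m k \<in> carrier_mat d d" for k
    using A P by auto
  have M: "?M ^\<^sub>m m = four_block_mat (A ^\<^sub>m m) ?Z ?Z (?Z ^\<^sub>m m)" for m
    by (rule pow_four_block_mat[OF A]) auto
  have "?J ^\<^sub>m Suc (Suc k) = ?J ^\<^sub>m k * (?J * ?J)" for k
    using MJ(2) pow_carrier_mat[OF MJ(2)] by (simp add: assoc_mult_mat[of _ "d + d" "d + d" _ "d + d" _ "d + d"])
  moreover have "?J * ?J = four_block_mat P ?Z ?Z P"
    using P by (subst mult_four_block_mat[of _ d d _ d _ d _ _ d _ d]) auto
  ultimately have J2: "?J ^\<^sub>m Suc (Suc k) = ?J ^\<^sub>m k * four_block_mat P ?Z ?Z P" for k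
    by simp
  have J: "?J ^\<^sub>m (2 * l) = four_block_mat (P ^\<^sub>m l) ?Z ?Z (P ^\<^sub>m l)" for l
  proof (induction l)
    case 0
    then show ?case using P by simp
  next
    case (Suc l)
    have "?J ^\<^sub>m (2 * Suc l) = ?J ^\<^sub>m (2 * l) * four_block_mat P ?Z ?Z P"
      using J2[of "2 * l"] by simp
    then show ?case
      unfolding Suc using P pw by (subst (asm) mult_four_block_mat[of _ d d _ d _ d _ _ d _ d]) auto
  qed
  fix m l :: nat
  assume "m \<ge> 1"
  \<comment> \<open>For \<open>m = 0\<close> this block would be the identity and the second copy of
    \<open>P ^\<^sub>m l\<close> would survive.\<close>
  then have Z: "?Z ^\<^sub>m m = ?Z"
    by (cases m) auto
  have AP: "A ^\<^sub>m m * P ^\<^sub>m l \<in> carrier_mat d d"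
    using pw by (rule mult_carrier_mat)
  have "?M ^\<^sub>m m * ?J ^\<^sub>m (2 * l) = four_block_mat (A ^\<^sub>m m * P ^\<^sub>m l) ?Z ?Z ?Z"
    unfolding M J Z using pw
    by (subst mult_four_block_mat[of _ d d _ d _ d _ _ d _ d])
      (simp_all add: right_add_zero_mat[OF AP] left_mult_zero_mat[OF pw(2)] right_mult_zero_mat[OF pw(1)])
  moreover have "trace_mat (four_block_mat X ?Z ?Z ?Z) = trace_mat X" if X: "X \<in> carrier_mat d d" for X
  proof -
    have "dim_row X = d" "dim_col X = d" using X by auto
    then have "(\<Sum>i<d + d. four_block_mat X ?Z ?Z ?Z $$ (i, i)) = (\<Sum>i<d. X $$ (i, i))"
      by (intro sum.mono_neutral_cong_right) auto
    with X show ?thesis by (simp add: trace_mat_def)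
  qed
  ultimately show "trace_mat (?M ^\<^sub>m m * ?J ^\<^sub>m (2 * l)) = trace_mat (A ^\<^sub>m m * P ^\<^sub>m l)"
    using AP by simp
qed

section \<open>Counting words by traces of exterior powers\<close>

definition words :: "'b set \<Rightarrow> nat \<Rightarrow> 'b list set" where
  "words B m = {w. set w \<subseteq> B \<and> length w = m}"

lemma finite_words [simp]: "finite B \<Longrightarrow> finite (words B m)"
  unfolding words_def by (rule finite_lists_length_eq)

lemma sum_words_Suc:
  "(\<Sum>w\<in>words B (Suc m). h w) = (\<Sum>w\<in>words B m. \<Sum>a\<in>B. h (w @ [a]))"
  unfolding sum.cartesian_product
proof (rule sum.reindex_bij_witness[where i = "\<lambda>(w, a). w @ [a]" and j = "\<lambda>w. (butlast w, last w)"])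
  fix w assume w: "w \<in> words B (Suc m)"
  then have "w \<noteq> []" by (auto simp: words_def)
  then show "(case (butlast w, last w) of (w, a) \<Rightarrow> w @ [a]) = w"
    and "(case (butlast w, last w) of (w, a) \<Rightarrow> h (w @ [a])) = h w" by auto
  show "(butlast w, last w) \<in> words B m \<times> B"
    using w \<open>w \<noteq> []\<close> by (auto simp: words_def dest: in_set_butlastD)
qed (auto simp: words_def)

text \<open>Since kernels multiply as maps compose, the \<open>m\<close>-th power of the sum over
  letters expands into a sum over words of length \<open>m\<close>, each contributing the kernel of
  \<open>fold \<delta> w\<close>.\<close>

lemma trace_ext_kernel:
  fixes \<delta> :: "'b \<Rightarrow> 'q \<Rightarrow> 'q" and p :: "'q \<Rightarrow> 'q"
  assumes Q: "finite Q" "inj_on \<kappa> Q"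
    and \<delta>: "\<And>a. a \<in> B \<Longrightarrow> \<delta> a ` Q \<subseteq> Q" "\<And>a. a \<in> B \<Longrightarrow> \<delta> a z = z"
    and p: "p ` Q \<subseteq> Q" "p z = z"
    and ss: "distinct ss" "set ss = Pow (Q - {z})" and m: "m \<ge> 1"
  shows "trace_mat (kernel_mat ss (\<lambda>S T. \<Sum>a\<in>B. ext_kernel \<kappa> b (\<delta> a) S T) ^\<^sub>m m
       * kernel_mat ss (ext_kernel \<kappa> b p) ^\<^sub>m l) =
    (\<Sum>w\<in>words B m. \<Sum>S\<in>Pow (Q - {z}). ext_kernel \<kappa> b ((p ^^ l) \<circ> fold \<delta> w) S S)"
proof -
  let ?A = "kernel_mat ss (\<lambda>S T. \<Sum>a\<in>B. ext_kernel \<kappa> b (\<delta> a) S T)"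
  let ?P = "kernel_mat ss (ext_kernel \<kappa> b p)"
  have fold: "fold \<delta> w ` Q \<subseteq> Q" if "set w \<subseteq> B" for w
    using that
  proof (induction w)
    case (Cons a w)
    then show ?case using \<delta>(1)[of a] by (auto simp: image_subset_iff)
  qed auto
  have pl: "(p ^^ l) ` Q \<subseteq> Q" for l
    by (induction l) (use p(1) in auto)
  \<comment> \<open>The induction starts at 1: the zeroth power is the identity matrix, which is
    nonzero also at the empty set and at sets of the wrong parity, where the kernel
    vanishes.\<close>
  have A: "?A ^\<^sub>m m = kernel_mat ss (\<lambda>S T. \<Sum>w\<in>words B m. ext_kernel \<kappa> b (fold \<delta> w) S T)"
    using m
  proof (induction m rule: nat_induct_at_least)
    case base
    have "words B 0 = {[]}" by (auto simp: words_def)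
    then have "(\<Sum>w\<in>words B 1. ext_kernel \<kappa> b (fold \<delta> w) S T) = (\<Sum>a\<in>B. ext_kernel \<kappa> b (\<delta> a) S T)" for S T
      using sum_words_Suc[of "\<lambda>w. ext_kernel \<kappa> b (fold \<delta> w) S T" B 0] by simp
    then show ?case
      using left_mult_one_mat[OF kernel_mat_carrier] by (simp add: kernel_mat_def)
  next
    case (Suc m)
    have "(\<Sum>R\<in>set ss. (\<Sum>w\<in>words B m. ext_kernel \<kappa> b (fold \<delta> w) S R) * (\<Sum>a\<in>B. ext_kernel \<kappa> b (\<delta> a) R T)) =
        (\<Sum>w\<in>words B (Suc m). ext_kernel \<kappa> b (fold \<delta> w) S T)"
      if ST: "S \<in> set ss" "T \<in> set ss" for S T
    proof -
      have "(\<Sum>R\<in>set ss. (\<Sum>w\<in>words B m. ext_kernel \<kappa> b (fold \<delta> w) S R) * (\<Sum>a\<in>B. ext_kernel \<kappa> b (\<delta> a) R T)) =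
        (\<Sum>R\<in>set ss. \<Sum>w\<in>words B m. \<Sum>a\<in>B. ext_kernel \<kappa> b (fold \<delta> w) S R * ext_kernel \<kappa> b (\<delta> a) R T)"
        by (simp add: sum_product)
      also have "\<dots> = (\<Sum>w\<in>words B m. \<Sum>R\<in>set ss. \<Sum>a\<in>B. ext_kernel \<kappa> b (fold \<delta> w) S R * ext_kernel \<kappa> b (\<delta> a) R T)"
        by (rule sum.swap)
      also have "\<dots> = (\<Sum>w\<in>words B m. \<Sum>a\<in>B. \<Sum>R\<in>set ss. ext_kernel \<kappa> b (fold \<delta> w) S R * ext_kernel \<kappa> b (\<delta> a) R T)"
        by (intro sum.cong refl sum.swap)
      also have "\<dots> = (\<Sum>w\<in>words B m. \<Sum>a\<in>B. ext_kernel \<kappa> b (fold \<delta> (w @ [a])) S T)"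
      proof (intro sum.cong refl)
        fix w a assume "w \<in> words B m" "a \<in> B"
        then have "fold \<delta> w ` Q \<subseteq> Q" "\<delta> a z = z"
          using fold \<delta>(2) by (auto simp: words_def)
        then show "(\<Sum>R\<in>set ss. ext_kernel \<kappa> b (fold \<delta> w) S R * ext_kernel \<kappa> b (\<delta> a) R T) =
            ext_kernel \<kappa> b (fold \<delta> (w @ [a])) S T"
          using ext_kernel_comp[OF Q, of "fold \<delta> w" "\<delta> a" z S T b] ST
          by (simp add: ss comp_def)
      qed
      finally show ?thesis by (simp add: sum_words_Suc)
    qed
    then show ?case
      by (simp add: Suc.IH kernel_mat_mult[OF ss(1)] cong: kernel_mat_cong)
  qed
  \<comment> \<open>Here the induction may start at \<open>l = 0\<close>: the identity matrix is
    multiplied by \<open>?A ^\<^sub>m m\<close>, which already has the required zeros.\<close>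
  have "?A ^\<^sub>m m * ?P ^\<^sub>m l =
      kernel_mat ss (\<lambda>S T. \<Sum>w\<in>words B m. ext_kernel \<kappa> b ((p ^^ l) \<circ> fold \<delta> w) S T)"
  proof (induction l)
    case 0
    show ?case
      using right_mult_one_mat[OF kernel_mat_carrier] by (simp add: A) (simp add: kernel_mat_def)
  next
    case (Suc l)
    have eq: "(\<Sum>R\<in>set ss. (\<Sum>w\<in>words B m. ext_kernel \<kappa> b ((p ^^ l) \<circ> fold \<delta> w) S R) * ext_kernel \<kappa> b p R T) =
        (\<Sum>w\<in>words B m. ext_kernel \<kappa> b ((p ^^ Suc l) \<circ> fold \<delta> w) S T)"
      if ST: "S \<in> set ss" "T \<in> set ss" for S T
    proof -
      have "(\<Sum>R\<in>set ss. (\<Sum>w\<in>words B m. ext_kernel \<kappa> b ((p ^^ l) \<circ> fold \<delta> w) S R) * ext_kernel \<kappa> b p R T) =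
        (\<Sum>w\<in>words B m. \<Sum>R\<in>set ss. ext_kernel \<kappa> b ((p ^^ l) \<circ> fold \<delta> w) S R * ext_kernel \<kappa> b p R T)"
        unfolding sum_distrib_right by (rule sum.swap)
      also have "\<dots> = (\<Sum>w\<in>words B m. ext_kernel \<kappa> b ((p ^^ Suc l) \<circ> fold \<delta> w) S T)"
      proof (intro sum.cong refl)
        fix w assume "w \<in> words B m"
        then have "((p ^^ l) \<circ> fold \<delta> w) ` Q \<subseteq> Q"
          using fold[of w] pl[of l] by (auto simp: words_def)
        then show "(\<Sum>R\<in>set ss. ext_kernel \<kappa> b ((p ^^ l) \<circ> fold \<delta> w) S R * ext_kernel \<kappa> b p R T) =
            ext_kernel \<kappa> b ((p ^^ Suc l) \<circ> fold \<delta> w) S T"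
          using ext_kernel_comp[OF Q, of "(p ^^ l) \<circ> fold \<delta> w" p z S T b] ST p(2)
          by (simp add: ss comp_assoc)
      qed
      finally show ?thesis .
    qed
    have "?A ^\<^sub>m m * ?P ^\<^sub>m Suc l = (?A ^\<^sub>m m * ?P ^\<^sub>m l) * ?P"
      unfolding pow_mat.simps
      by (rule assoc_mult_mat[OF pow_carrier_mat pow_carrier_mat, symmetric]) (rule kernel_mat_carrier)+
    then show ?case
      unfolding Suc.IH kernel_mat_mult[OF ss(1)] by (simp only: eq cong: kernel_mat_cong)
  qed
  then show ?thesis
    by (simp add: trace_kernel_mat[OF ss(1)]) (simp add: ss(2) sum.swap[of _ "words B m"])
qed

text \<open>By \<open>sum_ext_kernel\<close>, the odd minus the even trace is, for each word, the
  indicator of an invariant set. Each parity gives one pair of matrices.\<close>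

lemma card_words_with_invariant_set:
  fixes \<delta> :: "'b \<Rightarrow> 'q \<Rightarrow> 'q" and p :: "'q \<Rightarrow> 'q"
  assumes Q: "finite Q" and B: "finite B"
    and \<delta>: "\<And>a. a \<in> B \<Longrightarrow> \<delta> a ` Q \<subseteq> Q" "\<And>a. a \<in> B \<Longrightarrow> \<delta> a z = z"
    and p: "p ` Q \<subseteq> Q" "p z = z"
  shows "\<exists>d (M :: int mat) J M' J'. d \<ge> 1 \<and> {M, J, M', J'} \<subseteq> carrier_mat d d \<and>
    (\<forall>m\<ge>1. \<forall>l. int (card {w \<in> words B m. \<exists>C. C \<noteq> {} \<and> C \<subseteq> Q - {z} \<and> ((p ^^ l) \<circ> fold \<delta> w) ` C = C}) =
      trace_mat (M ^\<^sub>m m * J ^\<^sub>m (2 * l)) - trace_mat (M' ^\<^sub>m m * J' ^\<^sub>m (2 * l)))"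
proof -
  obtain h :: "'q \<Rightarrow> nat" where h: "inj_on h Q"
    using finite_imp_inj_to_nat_seg[OF Q] by auto
  define \<kappa> where "\<kappa> = int \<circ> h"
  have \<kappa>: "inj_on \<kappa> Q"
    using h by (auto simp: \<kappa>_def inj_on_def)
  obtain ss where ss: "distinct ss" "set ss = Pow (Q - {z})"
    using finite_distinct_list[of "Pow (Q - {z})"] Q by auto
  define d where "d = length ss"
  \<comment> \<open>The empty set is an entry of \<open>ss\<close>, so the size is positive even if
    \<open>Q - {z}\<close> is empty.\<close>
  have "ss \<noteq> []" using ss(2) by auto
  then have d: "d + d \<ge> 1" by (cases ss) (auto simp: d_def)
  define A where "A = (\<lambda>b. kernel_mat ss (\<lambda>S T. \<Sum>a\<in>B. ext_kernel \<kappa> b (\<delta> a) S T))"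
  define P where "P = (\<lambda>b. kernel_mat ss (ext_kernel \<kappa> b p))"
  have AP: "A b \<in> carrier_mat d d" "P b \<in> carrier_mat d d" for b
    by (simp_all add: A_def P_def d_def)
  obtain M J where M: "M \<in> carrier_mat (d + d) (d + d)" "J \<in> carrier_mat (d + d) (d + d)"
    "\<And>m l. m \<ge> 1 \<Longrightarrow> trace_mat (M ^\<^sub>m m * J ^\<^sub>m (2 * l)) = trace_mat (A False ^\<^sub>m m * P False ^\<^sub>m l)"
    using trace_mult_block_square_root[OF AP[of False]] by blast
  obtain M' J' where M': "M' \<in> carrier_mat (d + d) (d + d)" "J' \<in> carrier_mat (d + d) (d + d)"
    "\<And>m l. m \<ge> 1 \<Longrightarrow> trace_mat (M' ^\<^sub>m m * J' ^\<^sub>m (2 * l)) = trace_mat (A True ^\<^sub>m m * P True ^\<^sub>m l)"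
    using trace_mult_block_square_root[OF AP[of True]] by blast
  have "int (card {w \<in> words B m. \<exists>C. C \<noteq> {} \<and> C \<subseteq> Q - {z} \<and> ((p ^^ l) \<circ> fold \<delta> w) ` C = C}) =
      trace_mat (M ^\<^sub>m m * J ^\<^sub>m (2 * l)) - trace_mat (M' ^\<^sub>m m * J' ^\<^sub>m (2 * l))"
    if m: "m \<ge> 1" for m l
  proof -
    let ?U = "Q - {z}"
    have U: "finite ?U" "inj_on \<kappa> ?U"
      using Q \<kappa> by (auto intro: inj_on_subset)
    have "trace_mat (M ^\<^sub>m m * J ^\<^sub>m (2 * l)) - trace_mat (M' ^\<^sub>m m * J' ^\<^sub>m (2 * l)) =
      (\<Sum>w\<in>words B m. (\<Sum>S\<in>Pow ?U. ext_kernel \<kappa> False ((p ^^ l) \<circ> fold \<delta> w) S S)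
        - (\<Sum>S\<in>Pow ?U. ext_kernel \<kappa> True ((p ^^ l) \<circ> fold \<delta> w) S S))"
      unfolding M(3)[OF m] M'(3)[OF m] A_def P_def
      using trace_ext_kernel[where \<delta> = \<delta> and B = B, OF Q \<kappa> _ _ p ss m] \<delta> by (simp add: sum_subtractf)
    also have "\<dots> = (\<Sum>w\<in>words B m. if \<exists>C. C \<noteq> {} \<and> C \<subseteq> ?U \<and> ((p ^^ l) \<circ> fold \<delta> w) ` C = C then 1 else 0)"
      unfolding sum_ext_kernel[OF U] ..
    also have "\<dots> = int (card {w \<in> words B m. \<exists>C. C \<noteq> {} \<and> C \<subseteq> ?U \<and> ((p ^^ l) \<circ> fold \<delta> w) ` C = C})"
      using B by (simp add: sum.If_cases Int_def)
    finally show ?thesis by simp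
  qed
  with d M(1,2) M'(1,2) show ?thesis
    by (intro exI[of _ "d + d"] exI[of _ M] exI[of _ J] exI[of _ M'] exI[of _ J']) simp
qed

subsection \<open>Follower sets\<close>

text \<open>If \<open>f\<close> does not map \<open>D\<close> onto itself, pass to the smaller
  image; finiteness stops the descent.\<close>

lemma exists_invariant_subset:
  assumes "finite D" "D \<noteq> {}" "f ` D \<subseteq> D"
  shows "\<exists>C. C \<noteq> {} \<and> C \<subseteq> D \<and> f ` C = C"
  using assms
proof (induction D rule: finite_psubset_induct)
  case (psubset D)
  show ?case
  proof (cases "f ` D = D")
    case True
    with psubset.prems(1) show ?thesis by (intro exI[of _ D]) simp
  next
    case False
    have "f ` D \<subset> D" "f ` D \<noteq> {}" "f ` (f ` D) \<subseteq> f ` D"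
      using False psubset.prems by (simp_all add: psubset_eq image_mono)
    from psubset.IH[OF this] obtain C where C: "C \<noteq> {}" "C \<subseteq> f ` D" "f ` C = C"
      by (elim exE conjE)
    show ?thesis
      using C(1,3) subset_trans[OF C(2) psubset.prems(2)] by (intro exI conjI)
  qed
qed

definition follower :: "'b list set \<Rightarrow> 'b list \<Rightarrow> 'b list set" where
  "follower L u = {v. u @ v \<in> L}"

text \<open>Unfolds to the images of \<open>w\<close> under the \<open>n\<close>-th, ..., second and
  first power of \<open>t\<close>, in this order. Appending \<open>w\<close> before applying
  \<open>t\<close> mirrors one round of the automaton: read \<open>w\<close>, then apply the
  symmetry.\<close>

primrec twisted_rep :: "('b \<Rightarrow> 'b) \<Rightarrow> 'b list \<Rightarrow> nat \<Rightarrow> 'b list" where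
  "twisted_rep t w 0 = []"
| "twisted_rep t w (Suc n) = map t (twisted_rep t w n @ w)"

text \<open>The empty follower set plays the role of the sink.\<close>

lemma card_twisted_words:
  fixes L :: "'b list set" and \<tau> :: "'b \<Rightarrow> 'b"
  assumes B: "finite B" and fin: "finite (range (follower L))"
    and factorial: "\<forall>u v. u @ v \<in> L \<longrightarrow> u \<in> L \<and> v \<in> L"
    and \<tau>: "surj \<tau>" "\<And>w. map \<tau> w \<in> L \<longleftrightarrow> w \<in> L"
  shows "\<exists>d (M :: int mat) J M' J'. d \<ge> 1 \<and> {M, J, M', J'} \<subseteq> carrier_mat d d \<and>
    (\<forall>m\<ge>1. \<forall>l. int (card {w \<in> words B m. \<forall>n. twisted_rep (\<tau> ^^ l) w n \<in> L}) =
      trace_mat (M ^\<^sub>m m * J ^\<^sub>m (2 * l)) - trace_mat (M' ^\<^sub>m m * J' ^\<^sub>m (2 * l)))"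
proof -
  define Q where "Q = insert {} (range (follower L))"
  define \<delta> where "\<delta> = (\<lambda>a F. {v. a # v \<in> F} :: 'b list set)"
  define p where "p = (\<lambda>F. map \<tau> ` F)"
  have map_surj: "\<exists>v'. v = map \<tau> v'" for v
    unfolding ex_map_conv[symmetric] using surjD[OF \<tau>(1)] by (simp add: ex_map_conv)
  have \<delta>: "\<delta> a (follower L u) = follower L (u @ [a])" for a u
    by (auto simp: \<delta>_def follower_def)
  \<comment> \<open>Surjectivity of \<open>\<tau>\<close> makes every continuation of
    \<open>map \<tau> u\<close> the image of a word, so \<open>p\<close> reaches the whole follower
    set.\<close>
  have p: "p (follower L u) = follower L (map \<tau> u)" for u
  proof (rule equalityI[rotated]; rule subsetI)
    fix v assume "v \<in> follower L (map \<tau> u)"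
    moreover obtain v' where "v = map \<tau> v'" using map_surj by blast
    ultimately show "v \<in> p (follower L u)"
      using \<tau>(2)[of "u @ v'"] by (auto simp: p_def follower_def)
  next
    fix v assume "v \<in> p (follower L u)"
    then show "v \<in> follower L (map \<tau> u)"
      using \<tau>(2)[of "u @ v'" for v'] by (auto simp: p_def follower_def)
  qed
  have fold: "fold \<delta> w (follower L u) = follower L (u @ w)" for w u
    by (induction w arbitrary: u) (auto simp: \<delta>)
  have pl: "(p ^^ l) (follower L u) = follower L (map (\<tau> ^^ l) u)" for l u
    by (induction l) (simp_all add: p comp_def)
  have iff: "(\<exists>C. C \<noteq> {} \<and> C \<subseteq> Q - {{}} \<and> ((p ^^ l) \<circ> fold \<delta> w) ` C = C) \<longleftrightarrow>
      (\<forall>n. twisted_rep (\<tau> ^^ l) w n \<in> L)" (is "_ \<longleftrightarrow> ?R") for l w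
  proof -
    let ?t = "\<tau> ^^ l"
    define h where "h = (p ^^ l) \<circ> fold \<delta> w"
    have f: "(h ^^ n) (follower L u) = follower L (map (?t ^^ n) u @ twisted_rep ?t w n)" for n u
      by (induction n) (simp_all add: h_def fold pl comp_def)
    show ?thesis
      unfolding h_def[symmetric]
    proof
      assume "\<exists>C. C \<noteq> {} \<and> C \<subseteq> Q - {{}} \<and> h ` C = C"
      then obtain C where C: "C \<noteq> {}" "C \<subseteq> Q - {{}}" "h ` C = C" by blast
      then obtain q where "q \<in> C" "q \<in> range (follower L)" unfolding Q_def by blast
      then obtain u where u: "follower L u \<in> C" by blast
      have "(h ^^ n) (follower L u) \<in> C" for n
      proof (induction n)
        case (Suc n)
        then have "h ((h ^^ n) (follower L u)) \<in> h ` C" by blast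
        then show ?case unfolding C(3) by simp
      qed (use u in simp)
      \<comment> \<open>States in \<open>C\<close> are nonempty, so the label of each iterate
        extends to a word of \<open>L\<close>; its factor \<open>twisted_rep ?t w n\<close> then
        lies in \<open>L\<close> too.\<close>
      then have ne: "follower L (map (?t ^^ n) u @ twisted_rep ?t w n) \<noteq> {}" for n
        using C(2) unfolding f by blast
      show ?R
      proof
        fix n
        obtain v where "(map (?t ^^ n) u @ twisted_rep ?t w n) @ v \<in> L"
          using ne[of n] by (auto simp: follower_def)
        from factorial[rule_format, OF factorial[rule_format, OF this, THEN conjunct1]] show "twisted_rep ?t w n \<in> L" ..
      qed
    next
      assume R: ?R
      \<comment> \<open>Conversely, the forward orbit of the initial state is finite, avoids the
        sink and is mapped into itself, so it contains an invariant subset.\<close>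
      define D where "D = range (\<lambda>n. (h ^^ n) (follower L []))"
      have D: "D = range (\<lambda>n. follower L (twisted_rep ?t w n))"
        using f[of _ "[]"] by (simp add: D_def)
      have "h ` D \<subseteq> D"
      proof (rule image_subsetI)
        fix q assume "q \<in> D"
        then obtain n where "q = (h ^^ n) (follower L [])" by (auto simp: D_def)
        then have "h q = (h ^^ Suc n) (follower L [])" by simp
        then show "h q \<in> D" unfolding D_def by blast
      qed
      moreover have "D \<subseteq> Q" by (auto simp: D Q_def)
      moreover have "{} \<notin> D"
      proof
        assume "{} \<in> D"
        then obtain n where "follower L (twisted_rep ?t w n) = {}" by (auto simp: D)
        moreover have "[] \<in> follower L (twisted_rep ?t w n)" using R by (simp add: follower_def)
        ultimately show False by simp
      qed
      moreover have "finite D" "D \<noteq> {}"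
        using fin finite_subset[of D "range (follower L)"] by (auto simp: D)
      ultimately obtain C where "C \<noteq> {}" "C \<subseteq> D" "h ` C = C"
        using exists_invariant_subset[of D h] by blast
      moreover from \<open>C \<subseteq> D\<close> \<open>D \<subseteq> Q\<close> \<open>{} \<notin> D\<close> have "C \<subseteq> Q - {{}}" by blast
      ultimately show "\<exists>C. C \<noteq> {} \<and> C \<subseteq> Q - {{}} \<and> h ` C = C" by blast
    qed
  qed
  have Q: "finite Q" using fin by (simp add: Q_def)
  have \<delta>Q: "\<delta> a ` Q \<subseteq> Q" "\<delta> a {} = {}" for a
  proof -
    show "\<delta> a {} = {}" by (simp add: \<delta>_def)
    then show "\<delta> a ` Q \<subseteq> Q" unfolding Q_def image_insert by (simp add: image_subset_iff \<delta>)
  qed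
  have pQ: "p ` Q \<subseteq> Q" "p {} = {}"
  proof -
    show "p {} = {}" by (simp add: p_def)
    then show "p ` Q \<subseteq> Q" unfolding Q_def image_insert by (simp add: image_subset_iff p)
  qed
  show ?thesis
    using card_words_with_invariant_set[of Q B \<delta> "{}" p, OF Q B \<delta>Q pQ] unfolding iff .
qed

subsection \<open>Shift spaces\<close>

definition shift_by :: "int \<Rightarrow> (int \<Rightarrow> 'a) \<Rightarrow> int \<Rightarrow> 'a" where
  "shift_by k x = (\<lambda>i. x (i + k))"

lemma shift_by_shift_by [simp]: "shift_by k (shift_by l x) = shift_by (k + l) x"
  by (auto simp: shift_by_def algebra_simps)

lemma shift_by_0 [simp]: "shift_by 0 x = x"
  by (simp add: shift_by_def)

lemma shift_eq_shift_by: "shift = shift_by 1"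
  by (auto simp: shift_by_def shift_def)

lemma funpow_shift: "(shift ^^ m) x = shift_by (int m) x"
  by (induction m) (auto simp: shift_eq_shift_by)

lemma shift_by_mem:
  assumes "shift ` X = X" "x \<in> X"
  shows "shift_by k x \<in> X"
proof (induction k rule: int_induct[where k = 0])
  case (step1 i)
  then have "shift (shift_by i x) \<in> X" using assms(1) by blast
  then show ?case by (simp add: shift_eq_shift_by add.commute)
next
  case (step2 i)
  then obtain y where "y \<in> X" "shift_by i x = shift y" using assms(1) by blast
  then have "shift_by (- 1) (shift_by i x) \<in> X" by (simp add: shift_eq_shift_by)
  then show ?case by simp
qed (use assms(2) in simp)

lemma shift_by_commute:
  assumes X: "shift ` X = X" "x \<in> X" and g: "\<And>x. x \<in> X \<Longrightarrow> g (shift x) = shift (g x)"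
  shows "g (shift_by k x) = shift_by k (g x)"
proof (induction k rule: int_induct[where k = 0])
  case (step1 i)
  then show ?case
    using g[OF shift_by_mem[OF X, of i]] by (simp add: shift_eq_shift_by add.commute)
next
  case (step2 i)
  have "shift (g (shift_by (i - 1) x)) = shift_by i (g x)"
    using g[OF shift_by_mem[OF X, of "i - 1"]] step2 by (simp add: shift_eq_shift_by)
  then have "shift_by (- 1) (shift (g (shift_by (i - 1) x))) = shift_by (- 1) (shift_by i (g x))"
    by simp
  then show ?case by (simp add: shift_eq_shift_by)
qed simp

section \<open>Topology of the full shift and locality of continuous maps\<close>

lemma topspace_config_topology [simp]: "topspace (config_topology B) = {x. \<forall>i. x i \<in> B}"
  by (auto simp: config_topology_def)

lemma compact_space_config_topology: "finite B \<Longrightarrow> compact_space (config_topology B)"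
  by (auto simp: config_topology_def compact_space_product_topology compact_space_discrete_topology)

lemma continuous_map_coordinate: "continuous_map (config_topology B) (discrete_topology B) (\<lambda>x. x i)"
  unfolding config_topology_def by (rule continuous_map_product_projection) simp

lemma clopen_fiber:
  assumes "continuous_map T (discrete_topology D) k"
  shows "openin T {x \<in> topspace T. k x = a}" "closedin T {x \<in> topspace T. k x = a}"
proof -
  \<comment> \<open>Since \<open>a\<close> need not lie in \<open>D\<close>, the fiber is taken over
    \<open>{a} \<inter> D\<close>, which is open and closed in every case.\<close>
  have "{x \<in> topspace T. k x = a} = {x \<in> topspace T. k x \<in> {a} \<inter> D}"
    using continuous_map_image_subset_topspace[OF assms] by auto
  then show "openin T {x \<in> topspace T. k x = a}" "closedin T {x \<in> topspace T. k x = a}"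
    using openin_continuous_map_preimage[OF assms, of "{a} \<inter> D"]
      closedin_continuous_map_preimage[OF assms, of "{a} \<inter> D"] by auto
qed

lemma openin_cylinder:
  assumes "finite I"
  shows "openin (config_topology B) {x. (\<forall>i. x i \<in> B) \<and> (\<forall>i\<in>I. x i = y i)}"
  using assms
proof (induction I)
  case empty
  then show ?case using openin_topspace[of "config_topology B"] by simp
next
  case (insert j I)
  have "{x. (\<forall>i. x i \<in> B) \<and> (\<forall>i\<in>insert j I. x i = y i)} =
      {x. (\<forall>i. x i \<in> B) \<and> (\<forall>i\<in>I. x i = y i)} \<inter> {x. (\<forall>i. x i \<in> B) \<and> x j = y j}"
    by auto
  then show ?case
    using openin_Int[OF insert.IH] clopen_fiber(1)[OF continuous_map_coordinate[of B j], of "y j"] by simp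
qed

text \<open>The compactness argument of Curtis-Hedlund-Lyndon: around each point some finite window
  determines \<open>k\<close>, finitely many of the resulting cylinders cover \<open>Y\<close>, and
  the largest of their radii works uniformly.\<close>

lemma local_rule:
  assumes B: "finite B" and Y: "closedin (config_topology B) Y"
    and k: "continuous_map (shift_topology B Y) (discrete_topology D) k"
  obtains R :: nat where
    "\<And>y z. y \<in> Y \<Longrightarrow> z \<in> Y \<Longrightarrow> (\<And>i. \<bar>i\<bar> \<le> int R \<Longrightarrow> y i = z i) \<Longrightarrow> k y = k z"
proof -
  have YB: "Y \<subseteq> {x. \<forall>i. x i \<in> B}"
    using closedin_subset[OF Y] by simp
  have "\<exists>R :: nat. \<forall>z\<in>Y. (\<forall>i. \<bar>i\<bar> \<le> int R \<longrightarrow> z i = y i) \<longrightarrow> k z = k y" if y: "y \<in> Y" for y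
  proof -
    have "openin (shift_topology B Y) {z \<in> Y. k z = k y}"
      using clopen_fiber(1)[OF k, of "k y"] YB by (simp add: Int_absorb1)
    then obtain T where T: "openin (config_topology B) T" "{z \<in> Y. k z = k y} = T \<inter> Y"
      by (auto simp: openin_subtopology)
    have "y \<in> T" using T(2) y by blast
    then obtain U where U: "finite {i. U i \<noteq> B}" "y \<in> Pi\<^sub>E UNIV U" "Pi\<^sub>E UNIV U \<subseteq> T"
      using T(1) unfolding config_topology_def openin_product_topology_alt by auto
    obtain R where R: "\<bar>i\<bar> \<le> int R" if "i \<in> {i. U i \<noteq> B}" for i
    proof (rule that)
      fix i assume i: "i \<in> {i. U i \<noteq> B}"
      have "nat \<bar>i\<bar> \<le> Max ((\<lambda>i. nat \<bar>i\<bar>) ` {i. U i \<noteq> B})"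
        using U(1) i by (intro Max_ge) auto
      then show "\<bar>i\<bar> \<le> int (Max ((\<lambda>i. nat \<bar>i\<bar>) ` {i. U i \<noteq> B}))" by linarith
    qed
    have "k z = k y" if z: "z \<in> Y" and agree: "\<forall>i. \<bar>i\<bar> \<le> int R \<longrightarrow> z i = y i" for z
    proof -
      have "z i \<in> U i" for i
      proof (cases "U i = B")
        case False
        then have "z i = y i" using R agree by simp
        then show ?thesis using U(2) by (auto simp: PiE_iff)
      qed (use z YB in auto)
      then show ?thesis using U(3) T(2) z by auto
    qed
    then show ?thesis by blast
  qed
  then obtain \<rho> :: "(int \<Rightarrow> 'a) \<Rightarrow> nat" where
    \<rho>: "\<And>y z. y \<in> Y \<Longrightarrow> z \<in> Y \<Longrightarrow> (\<forall>i. \<bar>i\<bar> \<le> int (\<rho> y) \<longrightarrow> z i = y i) \<Longrightarrow> k z = k y"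
    by metis
  define cyl where "cyl = (\<lambda>y. {x. (\<forall>i. x i \<in> B) \<and> (\<forall>i\<in>{- int (\<rho> y)..int (\<rho> y)}. x i = y i)})"
  have "compactin (config_topology B) Y"
    using closedin_compact_space[OF compact_space_config_topology[OF B] Y] .
  moreover have "\<forall>U\<in>cyl ` Y. openin (config_topology B) U"
    using openin_cylinder by (auto simp: cyl_def)
  moreover have "Y \<subseteq> \<Union> (cyl ` Y)"
    using YB by (auto simp: cyl_def)
  ultimately obtain F where "finite F" "F \<subseteq> cyl ` Y" "Y \<subseteq> \<Union> F"
    unfolding compactin_def by meson
  then obtain G where G: "finite G" "G \<subseteq> Y" "Y \<subseteq> \<Union> (cyl ` G)"
    by (metis finite_subset_image)
  \<comment> \<open>The inserted 0 keeps the maximum defined when \<open>G\<close> is empty.\<close>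
  define R where "R = Max (insert 0 (\<rho> ` G))"
  have R: "\<rho> g \<le> R" if "g \<in> G" for g
    using G(1) that by (auto simp: R_def)
  show thesis
  proof (rule that)
    fix y z assume yz: "y \<in> Y" "z \<in> Y" and agree: "\<And>i. \<bar>i\<bar> \<le> int R \<Longrightarrow> y i = z i"
    obtain g where g: "g \<in> G" "y \<in> cyl g" using G(3) yz by blast
    have "y i = g i" if "\<bar>i\<bar> \<le> int (\<rho> g)" for i
      using g(2) that by (auto simp: cyl_def abs_le_iff)
    moreover from this have "z i = g i" if "\<bar>i\<bar> \<le> int (\<rho> g)" for i
      using agree[of i] R[OF g(1)] that by force
    ultimately have "k y = k g" "k z = k g"
      using \<rho>[of g] g G(2) yz by blast+
    then show "k y = k z" by simp
  qed
qed

section \<open>Shifts of finite type: closedness, invariance and splicing\<close>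

text \<open>Points with a given forbidden word at a given place form an open cylinder, and the
  complement of \<open>Y\<close> is the union of these cylinders.\<close>

lemma shift_of_finite_type_closed:
  assumes "shift_of_finite_type B Y"
  shows "closedin (config_topology B) Y"
proof -
  obtain F where F: "Y = {x. (\<forall>i. x i \<in> B) \<and> (\<forall>w\<in>F. \<not> occurs_in w x)}"
    using assms by (auto simp: shift_of_finite_type_def)
  define cyl where "cyl = (\<lambda>w i. {x. (\<forall>i. x i \<in> B) \<and>
    (\<forall>n\<in>(\<lambda>j. i + int j) ` {..<length w}. x n = (\<lambda>n. w ! nat (n - i)) n)})"
  have open_cyl: "openin (config_topology B) (cyl w i)" for w i
    unfolding cyl_def by (rule openin_cylinder) simp
  have "topspace (config_topology B) - Y = \<Union> (\<Union>w\<in>F. range (cyl w))"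
  proof (rule equalityI; rule subsetI)
    fix x assume "x \<in> topspace (config_topology B) - Y"
    then obtain w i where "w \<in> F" "\<forall>j<length w. x (i + int j) = w ! j" "\<forall>i. x i \<in> B"
      by (auto simp: F occurs_in_def)
    then have "x \<in> cyl w i" by (auto simp: cyl_def)
    with \<open>w \<in> F\<close> show "x \<in> \<Union> (\<Union>w\<in>F. range (cyl w))" by blast
  next
    fix x assume "x \<in> \<Union> (\<Union>w\<in>F. range (cyl w))"
    then obtain w i where w: "w \<in> F" "x \<in> cyl w i" by blast
    then have "occurs_in w x" "\<forall>i. x i \<in> B"
      unfolding occurs_in_def by (auto simp: cyl_def intro: exI[of _ i])
    with w(1) show "x \<in> topspace (config_topology B) - Y" by (auto simp: F)
  qed
  moreover have "openin (config_topology B) (\<Union> (\<Union>w\<in>F. range (cyl w)))"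
    using open_cyl by (intro openin_Union) blast
  ultimately show ?thesis
    unfolding closedin_def by (auto simp: F)
qed

lemma shift_of_finite_type_shift_invariant:
  assumes "shift_of_finite_type B Y"
  shows "shift ` Y = Y"
proof -
  obtain F where F: "Y = {x. (\<forall>i. x i \<in> B) \<and> (\<forall>w\<in>F. \<not> occurs_in w x)}"
    using assms by (auto simp: shift_of_finite_type_def)
  have occ: "occurs_in w (shift_by k x) \<longleftrightarrow> occurs_in w x" for w k and x :: "int \<Rightarrow> 'a"
  proof
    assume "occurs_in w (shift_by k x)"
    then obtain i where "\<forall>j<length w. x (i + int j + k) = w ! j"
      by (auto simp: occurs_in_def shift_by_def)
    then show "occurs_in w x"
      unfolding occurs_in_def by (intro exI[of _ "i + k"]) (simp add: algebra_simps)
  next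
    assume "occurs_in w x"
    then obtain i where "\<forall>j<length w. x (i + int j) = w ! j"
      by (auto simp: occurs_in_def)
    then show "occurs_in w (shift_by k x)"
      unfolding occurs_in_def by (intro exI[of _ "i - k"]) (simp add: shift_by_def algebra_simps)
  qed
  have mem: "shift_by k x \<in> Y" if "x \<in> Y" for k x
    using that by (simp add: F occ) (simp add: shift_by_def)
  show ?thesis
  proof
    show "shift ` Y \<subseteq> Y" using mem by (auto simp: shift_eq_shift_by)
    show "Y \<subseteq> shift ` Y"
    proof
      fix x assume "x \<in> Y"
      then show "x \<in> shift ` Y"
        using mem[of x "- 1"] by (intro image_eqI[of _ _ "shift_by (- 1) x"]) (auto simp: shift_eq_shift_by)
    qed
  qed
qed

text \<open>Take \<open>N\<close> at least the length of every forbidden word. An occurrence in the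
  spliced point that starts at a negative place ends before \<open>N\<close>, where the point still
  agrees with \<open>y\<close>; any other occurrence sees only \<open>z\<close>.\<close>

lemma shift_of_finite_type_splice:
  assumes "shift_of_finite_type B Y"
  obtains N :: nat where
    "\<And>y z. y \<in> Y \<Longrightarrow> z \<in> Y \<Longrightarrow> (\<And>i. \<bar>i\<bar> \<le> int N \<Longrightarrow> y i = z i) \<Longrightarrow> (\<lambda>i. if i < 0 then y i else z i) \<in> Y"
proof -
  obtain F where F: "finite F" "Y = {x. (\<forall>i. x i \<in> B) \<and> (\<forall>w\<in>F. \<not> occurs_in w x)}"
    using assms by (auto simp: shift_of_finite_type_def)
  define N where "N = Max (insert 0 (length ` F))"
  have N: "length w \<le> N" if "w \<in> F" for w
    using F(1) that by (auto simp: N_def)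
  show thesis
  proof (rule that)
    fix y z assume yz: "y \<in> Y" "z \<in> Y" and agree: "\<And>i. \<bar>i\<bar> \<le> int N \<Longrightarrow> y i = z i"
    let ?s = "\<lambda>i. if i < 0 then y i else z i"
    have "occurs_in w y \<or> occurs_in w z" if w: "w \<in> F" and "occurs_in w ?s" for w
    proof -
      obtain i where i: "?s (i + int j) = w ! j" if "j < length w" for j
        using \<open>occurs_in w ?s\<close> by (auto simp: occurs_in_def)
      show ?thesis
      proof (cases "i < 0")
        case True
        have "y (i + int j) = w ! j" if "j < length w" for j
          using i[OF that] agree[of "i + int j"] True that N[OF w] by (auto split: if_splits)
        then show ?thesis by (auto simp: occurs_in_def)
      next
        case False
        then have "z (i + int j) = w ! j" if "j < length w" for j
          using i[OF that] by auto
        then show ?thesis by (auto simp: occurs_in_def)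
      qed
    qed
    with yz show "?s \<in> Y" by (auto simp: F)
  qed
qed

section \<open>Words of points and finiteness of follower sets\<close>

definition word :: "(int \<Rightarrow> 'b) \<Rightarrow> int \<Rightarrow> nat \<Rightarrow> 'b list" where
  "word x i k = map (\<lambda>n. x (i + int n)) [0..<k]"

lemma length_word [simp]: "length (word x i k) = k"
  by (simp add: word_def)

lemma word_append: "word x i (k + l) = word x i k @ word x (i + int k) l"
  by (rule nth_equalityI) (auto simp: word_def nth_append algebra_simps)

lemma word_eq_iff: "word x i k = word y j k \<longleftrightarrow> (\<forall>n<k. x (i + int n) = y (j + int n))"
  by (auto simp: word_def list_eq_iff_nth_eq)

lemma word_shift_by: "word (shift_by n x) i k = word x (i + n) k"
  by (auto simp: word_def shift_by_def algebra_simps)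

text \<open>By splicing, what may follow \<open>u\<close> depends only on the set of windows on
  \<open>{-K..K}\<close> that can occur at the end of \<open>u\<close>, and there are finitely many
  such sets.\<close>

lemma finite_followers_of_local_code:
  assumes Y: "shift_of_finite_type B Y"
    and e: "\<And>y z. y \<in> Y \<Longrightarrow> z \<in> Y \<Longrightarrow> (\<And>i. \<bar>i\<bar> \<le> int R \<Longrightarrow> y i = z i) \<Longrightarrow> e y = e z"
  shows "finite (range (follower {word (\<lambda>i. e (shift_by i y)) j k | y j k. y \<in> Y}))"
proof -
  define c where "c = (\<lambda>y i. e (shift_by i y))"
  define L where "L = {word (c y) j k | y j k. y \<in> Y}"
  note inv = shift_by_mem[OF shift_of_finite_type_shift_invariant[OF Y]]
  obtain N where N: "\<And>y z. y \<in> Y \<Longrightarrow> z \<in> Y \<Longrightarrow> (\<And>i. \<bar>i\<bar> \<le> int N \<Longrightarrow> y i = z i) \<Longrightarrow>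
      (\<lambda>i. if i < 0 then y i else z i) \<in> Y"
    using shift_of_finite_type_splice[OF Y] by blast
  define K where "K = int (max R N)"
  have cs: "c (shift_by n y) = shift_by n (c y)" for n y
    by (auto simp: c_def shift_by_def add.assoc)
  have c_eq: "c y i = c z i" if "y \<in> Y" "z \<in> Y" "\<And>n. \<bar>n - i\<bar> \<le> int R \<Longrightarrow> y n = z n" for y z i
    unfolding c_def using that inv by (intro e) (auto simp: shift_by_def)
  \<comment> \<open>\<open>P u\<close> collects the windows around the origin of points whose code
    spells \<open>u\<close> just before the origin; \<open>G\<close> recovers the continuations from
    these windows alone.\<close>
  define P where "P = (\<lambda>u. {restrict y {-K..K} | y. y \<in> Y \<and> word (c y) (- int (length u)) (length u) = u})"
  define G where "G = (\<lambda>p. {v. \<exists>z\<in>Y. restrict z {-K..K} \<in> p \<and> word (c z) 0 (length v) = v})"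
  have follower: "follower L u = G (P u)" for u
  proof (rule equalityI; rule subsetI)
    fix v assume "v \<in> follower L u"
    then obtain y j k where y: "y \<in> Y" "u @ v = word (c y) j k"
      by (auto simp: follower_def L_def)
    then have "k = length u + length v" by (metis length_append length_word)
    with y(2) have "u = word (c y) j (length u)" "v = word (c y) (j + int (length u)) (length v)"
      by (auto simp: word_append append_eq_append_conv)
    then show "v \<in> G (P u)"
      using inv[OF y(1), of "j + int (length u)"]
      unfolding G_def P_def by (auto simp: cs word_shift_by intro!: bexI[of _ "shift_by (j + int (length u)) y"])
  next
    fix v assume "v \<in> G (P u)"
    then obtain y z where yz: "y \<in> Y" "z \<in> Y" "restrict z {-K..K} = restrict y {-K..K}"
      "word (c y) (- int (length u)) (length u) = u" "word (c z) 0 (length v) = v"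
      by (auto simp: G_def P_def)
    have agree: "y i = z i" if "\<bar>i\<bar> \<le> K" for i
      using fun_cong[OF yz(3), of i] that by (auto simp: abs_le_iff)
    \<comment> \<open>\<open>K\<close> is at least \<open>N\<close>, so \<open>s\<close> lies in
      \<open>Y\<close>; it is at least \<open>R\<close>, so codes at negative places are those of
      \<open>y\<close> and the others those of \<open>z\<close>.\<close>
    define s where "s = (\<lambda>i. if i < 0 then y i else z i)"
    have s: "s \<in> Y"
      unfolding s_def using yz agree by (intro N) (auto simp: K_def)
    have sy: "s i = y i" if "i \<le> K" for i
      using that agree[of i] by (auto simp: s_def)
    have sz: "s i = z i" if "- K \<le> i" for i
      using that agree[of i] by (auto simp: s_def)
    have "word (c s) (- int (length u)) (length u) = word (c y) (- int (length u)) (length u)"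
      unfolding word_eq_iff using s yz sy by (auto intro!: c_eq simp: K_def)
    moreover have "word (c s) 0 (length v) = word (c z) 0 (length v)"
      unfolding word_eq_iff using s yz sz by (auto intro!: c_eq simp: K_def)
    ultimately have "u @ v = word (c s) (- int (length u)) (length u + length v)"
      using yz by (simp add: word_append)
    then show "v \<in> follower L u"
      using s by (auto simp: follower_def L_def)
  qed
  have "finite B" "Y \<subseteq> {x. \<forall>i. x i \<in> B}"
    using Y by (auto simp: shift_of_finite_type_def)
  then have "range P \<subseteq> Pow (Pi\<^sub>E {-K..K} (\<lambda>_. B))" "finite (Pi\<^sub>E {-K..K} (\<lambda>_. B))"
    by (auto simp: P_def intro!: finite_PiE)
  then have "finite (range P)"
    using finite_subset finite_Pow_iff by metis
  then have "finite (G ` range P)" by simp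
  moreover have "range (follower L) = G ` range P"
    using follower by auto
  ultimately show ?thesis by (simp add: L_def c_def)
qed

subsection \<open>Automorphisms of finite order\<close>

text \<open>To be instantiated with the square of the reversal, which commutes with the shift and
  whose \<open>r\<close>-th power is the identity on \<open>X\<close>.\<close>

locale finite_order_automorphism =
  fixes A :: "'a set" and X :: "(int \<Rightarrow> 'a) set" and \<psi> :: "(int \<Rightarrow> 'a) \<Rightarrow> (int \<Rightarrow> 'a)" and r :: nat
  assumes finite_alphabet: "finite A" and closed: "closedin (config_topology A) X"
    and shift_X: "shift ` X = X"
    and continuous: "continuous_map (shift_topology A X) (shift_topology A X) \<psi>"
    and commute: "x \<in> X \<Longrightarrow> \<psi> (shift x) = shift (\<psi> x)"
    and order: "x \<in> X \<Longrightarrow> (\<psi> ^^ r) x = x"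
    and r_pos: "r \<ge> 1"
begin

text \<open>In this recoding, \<open>\<psi>\<close> acts on each letter separately, by a cyclic rotation.\<close>

definition code :: "(int \<Rightarrow> 'a) \<Rightarrow> int \<Rightarrow> 'a list" where
  "code x i = map (\<lambda>j. (\<psi> ^^ j) x i) [0..<r]"

definition letters :: "'a list set" where
  "letters = {a. set a \<subseteq> A \<and> length a = r}"

definition lang :: "'a list list set" where
  "lang = {word (code x) i k | x i k. x \<in> X}"

lemma X_alphabet: "X \<subseteq> {x. \<forall>i. x i \<in> A}"
  using closedin_subset[OF closed] by simp

lemma topspace_X [simp]: "topspace (shift_topology A X) = X"
  using X_alphabet by auto

lemma continuous_funpow: "continuous_map (shift_topology A X) (shift_topology A X) (\<psi> ^^ j)"
proof (induction j)
  case 0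
  then show ?case by (simp add: id_def)
next
  case (Suc j)
  show ?case
    unfolding funpow.simps using Suc continuous by (rule continuous_map_compose)
qed

lemma funpow_mem: "x \<in> X \<Longrightarrow> (\<psi> ^^ j) x \<in> X"
  using continuous_map_image_subset_topspace[OF continuous_funpow[of j]] unfolding topspace_X by blast

lemma funpow_shift_by: "x \<in> X \<Longrightarrow> (\<psi> ^^ j) (shift_by k x) = shift_by k ((\<psi> ^^ j) x)"
proof (induction j)
  case (Suc j)
  then show ?case
    using shift_by_commute[of X "(\<psi> ^^ j) x" \<psi> k] shift_X commute funpow_mem by simp
qed simp

lemma code_shift_by: "x \<in> X \<Longrightarrow> code (shift_by k x) i = code x (i + k)"
  by (simp add: code_def funpow_shift_by) (simp add: shift_by_def)

lemma length_code [simp]: "length (code x i) = r"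
  by (simp add: code_def)

lemma code_in_letters: "x \<in> X \<Longrightarrow> code x i \<in> letters"
  using funpow_mem X_alphabet by (fastforce simp: letters_def code_def)

lemma finite_letters: "finite letters"
  unfolding letters_def using finite_alphabet by (rule finite_lists_length_eq)

lemma code_eq_imp_eq:
  assumes "\<And>i. code x i = code y i"
  shows "x = y"
proof
  fix i
  have "code x i ! 0 = code y i ! 0" using assms by simp
  then show "x i = y i" using r_pos by (simp add: code_def)
qed

lemma code_automorphism:
  assumes "x \<in> X"
  shows "code (\<psi> x) i = rotate1 (code x i)"
proof (rule nth_equalityI)
  fix j assume "j < length (code (\<psi> x) i)"
  then have j: "j < r" by simp
  \<comment> \<open>Entry \<open>j\<close> of the new letter is entry \<open>j + 1\<close> of the
    old one; the last entry wraps around to entry 0 because \<open>\<psi> ^^ r\<close> fixes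
    \<open>x\<close>.\<close>
  have "(\<psi> ^^ j) (\<psi> x) = (\<psi> ^^ (Suc j mod r)) x"
  proof (cases "Suc j = r")
    case True
    then show ?thesis using order[OF assms] by (auto simp: funpow_swap1)
  next
    case False
    then show ?thesis using j by (simp add: funpow_swap1)
  qed
  then show "code (\<psi> x) i ! j = rotate1 (code x i) ! j"
    using j r_pos by (simp add: nth_rotate1) (simp add: code_def)
qed simp

lemma code_funpow: "x \<in> X \<Longrightarrow> code ((\<psi> ^^ l) x) i = rotate l (code x i)"
  by (induction l) (simp_all add: code_automorphism funpow_mem)

lemma fixed_iff:
  assumes "x \<in> X"
  shows "shift_by m ((\<psi> ^^ l) x) = x \<longleftrightarrow> (\<forall>i. rotate l (code x (i + m)) = code x i)"
proof -
  have "code (shift_by m ((\<psi> ^^ l) x)) i = rotate l (code x (i + m))" for i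
    using assms by (simp add: code_shift_by funpow_mem code_funpow)
  then show ?thesis using code_eq_imp_eq by metis
qed

lemma word_in_lang: "x \<in> X \<Longrightarrow> word (code x) i k \<in> lang"
  by (auto simp: lang_def)

lemma lang_factorial:
  assumes "u @ v \<in> lang"
  shows "u \<in> lang \<and> v \<in> lang"
proof -
  obtain x i k where x: "x \<in> X" "u @ v = word (code x) i k"
    using assms by (auto simp: lang_def)
  then have "k = length u + length v" by (metis length_append length_word)
  with x(2) have "u = word (code x) i (length u)" "v = word (code x) (i + int (length u)) (length v)"
    by (auto simp: word_append append_eq_append_conv)
  then show ?thesis using x(1) word_in_lang by metis
qed

lemma map_rotate_word: "x \<in> X \<Longrightarrow> map (rotate l) (word (code x) i k) = word (code ((\<psi> ^^ l) x)) i k"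
  by (simp add: word_def code_funpow)

lemma map_rotate_in_lang: "map (rotate l) w \<in> lang \<longleftrightarrow> w \<in> lang"
proof
  assume "w \<in> lang"
  then show "map (rotate l) w \<in> lang"
    using map_rotate_word funpow_mem word_in_lang by (auto simp: lang_def)
next
  assume "map (rotate l) w \<in> lang"
  then obtain x i k where x: "x \<in> X" "map (rotate l) w = word (code x) i k"
    by (auto simp: lang_def)
  \<comment> \<open>This power inverts \<open>\<psi> ^^ l\<close> on \<open>X\<close>: the exponents
    add up to \<open>r * l\<close>, the subtraction being exact as \<open>r \<ge> 1\<close>.\<close>
  define x' where "x' = (\<psi> ^^ (l * r - l)) x"
  have x': "x' \<in> X" unfolding x'_def using x(1) by (rule funpow_mem)
  have "(\<psi> ^^ l) x' = (\<psi> ^^ (l + (l * r - l))) x"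
    unfolding x'_def funpow_add comp_apply ..
  also have "l + (l * r - l) = r * l"
    using r_pos by (cases r) (simp_all add: mult.commute)
  also have "(\<psi> ^^ (r * l)) x = x"
    unfolding funpow_mult[symmetric] by (induction l) (simp_all add: order[OF x(1)])
  finally have "map (rotate l) w = map (rotate l) (word (code x') i k)"
    using x(2) map_rotate_word[OF x'] by simp
  moreover have "inj (rotate l :: 'a list \<Rightarrow> 'a list)"
    unfolding rotate_def using inj_rotate1 by (rule inj_fn)
  ultimately have "w = word (code x') i k"
    by (simp add: inj_map_eq_map)
  then show "w \<in> lang" using word_in_lang[OF x'] by simp
qed

text \<open>Compactness: the points with the prescribed code on a window form a decreasing sequence
  of nonempty closed sets.\<close>

lemma exists_point_with_code:
  assumes "\<And>N :: nat. \<exists>x\<in>X. \<forall>i. - int N \<le> i \<and> i < int N \<longrightarrow> code x i = y i"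
  shows "\<exists>x\<in>X. \<forall>i. code x i = y i"
proof -
  let ?T = "shift_topology A X"
  define K where "K = (\<lambda>N :: nat. {x \<in> X. \<forall>i. - int N \<le> i \<and> i < int N \<longrightarrow> code x i = y i})"
  have len: "length (y i) = r" for i
  proof -
    obtain x where "code x i = y i"
      using assms[of "Suc (nat \<bar>i\<bar>)"] by (fastforce dest: spec[of _ i])
    then show ?thesis by (metis length_code)
  qed
  have cl: "closedin ?T {x \<in> X. (\<psi> ^^ j) x i = a}" for i j a
  proof -
    have "continuous_map ?T (discrete_topology A) (\<lambda>x. (\<psi> ^^ j) x i)"
      using continuous_map_compose[OF continuous_funpow continuous_map_from_subtopology[OF continuous_map_coordinate]]
      by (simp add: comp_def)
    from clopen_fiber(2)[OF this, of a] show ?thesis unfolding topspace_X .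
  qed
  have "closedin ?T (K N)" for N
  proof -
    have "K N = X \<inter> (\<Inter>(i, j)\<in>{- int N..<int N} \<times> {..<r}. {x \<in> X. (\<psi> ^^ j) x i = y i ! j})"
      using len by (fastforce simp: K_def code_def list_eq_iff_nth_eq)
    \<comment> \<open>Inserting \<open>X\<close> keeps the family nonempty for
      \<open>N = 0\<close>.\<close>
    also have "\<dots> = \<Inter> (insert X ((\<lambda>(i, j). {x \<in> X. (\<psi> ^^ j) x i = y i ! j}) ` ({- int N..<int N} \<times> {..<r})))"
      by auto
    also have "closedin ?T \<dots>"
      using cl closedin_topspace[of ?T] unfolding topspace_X by (intro closedin_Inter) auto
    finally show ?thesis .
  qed
  moreover have "compact_space ?T"
    using closedin_compact_space[OF compact_space_config_topology[OF finite_alphabet] closed]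
    by (rule compact_space_subtopology)
  moreover have "K N \<noteq> {}" for N using assms[of N] by (auto simp: K_def)
  moreover have "decseq K" by (force simp: decseq_def K_def)
  ultimately obtain x where x: "x \<in> (\<Inter>N. K N)"
    using compact_space_imp_nest[of ?T K] by blast
  have K: "x \<in> X" "- int N \<le> i \<Longrightarrow> i < int N \<Longrightarrow> code x i = y i" for N i
    using INT_D[OF x UNIV_I, of N] by (simp_all add: K_def)
  have "code x i = y i" for i
    by (rule K(2)[of "Suc (nat \<bar>i\<bar>)"]) linarith+
  with K(1) show ?thesis by blast
qed

text \<open>Each move by \<open>m\<close> places to the left applies \<open>t\<close> once, so the
  twisted repetition is the stretch of \<open>y\<close> that ends just before the origin.\<close>

lemma twisted_rep_eq_word:
  assumes y: "\<And>i. t (y (i + int m)) = y i" and w: "w = word y 0 m"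
  shows "twisted_rep t w n = word y (- int (n * m)) (n * m)"
proof (induction n)
  case 0
  then show ?case by (simp add: word_def)
next
  case (Suc n)
  have "twisted_rep t w (Suc n) = map t (word y (- int (n * m)) (n * m + m))"
    using Suc w by (simp add: word_append)
  also have "\<dots> = word y (- int (n * m) - int m) (n * m + m)"
    using y[of "- int (n * m) - int m + int k" for k] by (simp add: word_def algebra_simps)
  also have "- int (n * m) - int m = - int (Suc n * m)"
    by simp
  finally show ?case by (simp add: add.commute)
qed

text \<open>A fixed point is determined by its first \<open>m\<close> letters through twisted
  periodicity. Conversely, \<open>w\<close> extends to a twisted periodic sequence whose windows lie
  in \<open>lang\<close>, and compactness yields a point of \<open>X\<close>.\<close>

lemma fixed_points_bij:
  assumes m: "m \<ge> 1"
  shows "bij_betw (\<lambda>x. word (code x) 0 m) {x \<in> X. shift_by (int m) ((\<psi> ^^ l) x) = x}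
    {w \<in> words letters m. \<forall>n. twisted_rep (rotate l) w n \<in> lang}"
    (is "bij_betw ?h ?F ?W")
  unfolding bij_betw_def
proof
  have per: "rotate l (code x (i + int m)) = code x i" if "x \<in> ?F" for x i
    using that fixed_iff by auto
  show "inj_on ?h ?F"
  proof (rule inj_onI)
    fix x x' assume x: "x \<in> ?F" "x' \<in> ?F" and h: "?h x = ?h x'"
    \<comment> \<open>Agreement passes from block \<open>d\<close> to block \<open>d - 1\<close> by
      applying the rotation, and to block \<open>d + 1\<close> by cancelling it.\<close>
    have "\<forall>j<m. code x (int j + int m * d) = code x' (int j + int m * d)" for d
    proof (induction d rule: int_induct[where k = 0])
      case base
      then show ?case using h by (simp add: word_eq_iff)
    next
      case (step1 d)
      have inj: "inj (rotate l :: 'a list \<Rightarrow> 'a list)"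
        unfolding rotate_def using inj_rotate1 by (rule inj_fn)
      show ?case
      proof (intro allI impI)
        fix j assume "j < m"
        with step1 have "code x (int j + int m * d) = code x' (int j + int m * d)" by blast
        then have "rotate l (code x (int j + int m * d + int m)) = rotate l (code x' (int j + int m * d + int m))"
          unfolding per[OF x(1)] per[OF x(2)] .
        then have "code x (int j + int m * d + int m) = code x' (int j + int m * d + int m)"
          by (rule injD[OF inj])
        then show "code x (int j + int m * (d + 1)) = code x' (int j + int m * (d + 1))"
          by (simp only: distrib_left mult_1_right add.assoc)
      qed
    next
      case (step2 d)
      show ?case
      proof (intro allI impI)
        fix j assume "j < m"
        with step2 have "code x (int j + int m * d) = code x' (int j + int m * d)" by blast
        moreover have "int j + int m * d = int j + int m * (d - 1) + int m"
          by (simp add: algebra_simps)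
        ultimately show "code x (int j + int m * (d - 1)) = code x' (int j + int m * (d - 1))"
          using per[OF x(1), of "int j + int m * (d - 1)"] per[OF x(2), of "int j + int m * (d - 1)"]
          by (simp only:)
      qed
    qed
    note eq = this
    have "code x i = code x' i" for i
    proof -
      have "int (nat (i mod int m)) = i mod int m" using m by simp
      then have i: "int (nat (i mod int m)) + int m * (i div int m) = i" by simp
      have "nat (i mod int m) < m" using m by (simp add: nat_less_iff)
      with eq[of "i div int m"] have "code x (int (nat (i mod int m)) + int m * (i div int m)) =
          code x' (int (nat (i mod int m)) + int m * (i div int m))" by blast
      then show ?thesis unfolding i .
    qed
    then show "x = x'" by (rule code_eq_imp_eq)
  qed
  show "?h ` ?F = ?W"
  proof (rule equalityI; rule subsetI)
    fix w assume "w \<in> ?h ` ?F"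
    then obtain x where x: "x \<in> ?F" "w = ?h x" by blast
    then have "w \<in> words letters m"
      using code_in_letters by (auto simp: words_def word_def)
    moreover have "twisted_rep (rotate l) w n \<in> lang" for n
      using twisted_rep_eq_word[of "rotate l" "code x" m w n] per[OF x(1)] x word_in_lang by simp
    ultimately show "w \<in> ?W" by blast
  next
    fix w assume w: "w \<in> ?W"
    then have "w \<in> words letters m" and w_lang: "\<And>n. twisted_rep (rotate l) w n \<in> lang"
      by blast+
    then have lw: "length w = m" and "set w \<subseteq> letters"
      by (simp_all add: words_def)
    then have letter: "length (w ! j) = r" if "j < m" for j
      using subsetD[OF _ nth_mem, of w letters j] that by (simp add: letters_def)
    \<comment> \<open>Moving right by \<open>m\<close> undoes one rotation by \<open>l\<close>, so
      block \<open>d\<close> is \<open>w\<close> rotated by \<open>- l * d\<close>. Letters have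
      length \<open>r\<close>, so a residue modulo \<open>r\<close> serves as a natural
      exponent.\<close>
    define q where "q = (\<lambda>d. nat ((- int l * d) mod int r))"
    define y where "y = (\<lambda>i. rotate (q (i div int m)) (w ! nat (i mod int m)))"
    have mod_m: "nat (i mod int m) < m" for i
      using m by (simp add: nat_less_iff)
    have q: "rotate l (rotate (q (d + 1)) a) = rotate (q d) a" if "length a = r" for d a
    proof -
      have iq: "int (q d) = (- int l * d) mod int r" for d
        using r_pos by (simp add: q_def)
      have "int ((l + q (d + 1)) mod r) = (int l + (- int l * (d + 1)) mod int r) mod int r"
        by (simp add: zmod_int iq)
      also have "\<dots> = (int l + - int l * (d + 1)) mod int r"
        by (rule mod_add_right_eq)
      also have "int l + - int l * (d + 1) = - int l * d"
        by (simp add: algebra_simps)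
      also have "(- int l * d) mod int r = int (q d mod r)"
        by (simp add: zmod_int iq)
      finally have "(l + q (d + 1)) mod r = q d mod r" by (simp only: of_nat_eq_iff)
      then show ?thesis
        using that rotate_conv_mod[of "l + q (d + 1)" a] rotate_conv_mod[of "q d" a]
        by (simp add: rotate_rotate)
    qed
    have y: "rotate l (y (i + int m)) = y i" for i
      unfolding y_def using m q[OF letter[OF mod_m]] by simp
    have wy: "w = word y 0 m"
      using lw by (intro nth_equalityI) (auto simp: word_def y_def q_def)
    have "\<exists>x\<in>X. \<forall>i. - int N \<le> i \<and> i < int N \<longrightarrow> code x i = y i" for N
    proof -
      \<comment> \<open>Twisted repetitions describe only the part of \<open>y\<close> left of the
        origin. Rotating \<open>N\<close> times carries the central window there, and
        \<open>map_rotate_in_lang\<close> then removes the rotation.\<close>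
      have "map (rotate l ^^ k) (word y i j) = word y (i - int (k * m)) j" for i j k
      proof (induction k)
        case (Suc k)
        have "map (rotate l ^^ Suc k) (word y i j) = map (rotate l) (word y (i - int (k * m)) j)"
          using Suc by (simp flip: map_map)
        also have "\<dots> = word y (i - int (k * m) - int m) j"
          using y[of "i - int (k * m) - int m + int n" for n] by (simp add: word_def algebra_simps)
        also have "i - int (k * m) - int m = i - int (Suc k * m)"
          by simp
        finally show ?case .
      qed (simp add: id_def)
      from this[of N "- int (N * m)" "2 * N * m"]
      have "map (rotate l ^^ N) (word y (- int (N * m)) (2 * N * m)) = word y (- int (2 * N * m)) (2 * N * m)"
        by (simp add: algebra_simps)
      also have "\<dots> = twisted_rep (rotate l) w (2 * N)"
        using twisted_rep_eq_word[of "rotate l" y m w "2 * N"] y wy by simp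
      also have "\<dots> \<in> lang" using w_lang .
      finally have "map (rotate (N * l)) (word y (- int (N * m)) (2 * N * m)) \<in> lang"
        by (simp add: rotate_def funpow_mult mult.commute)
      then have "word y (- int (N * m)) (2 * N * m) \<in> lang"
        by (simp only: map_rotate_in_lang)
      then obtain x i k where x: "x \<in> X" "word y (- int (N * m)) (2 * N * m) = word (code x) i k"
        by (auto simp: lang_def)
      then have k: "k = 2 * N * m" by (metis length_word)
      define x' where "x' = shift_by (i + int (N * m)) x"
      have "code x' n = y n" if "- int N \<le> n" "n < int N" for n
      proof -
        have "N * 1 \<le> N * m" using m by (intro mult_le_mono) auto
        then have "int N \<le> int (N * m)" by (simp only: of_nat_le_iff mult_1_right)
        moreover have "int (2 * N * m) = int (N * m) + int (N * m)" by (simp add: algebra_simps)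
        ultimately have n: "0 \<le> n + int (N * m)" "n + int (N * m) < int (2 * N * m)"
          using that by linarith+
        define p where "p = nat (n + int (N * m))"
        have p: "int p = n + int (N * m)" "p < 2 * N * m"
          using n unfolding p_def by (simp_all only: nat_less_iff int_nat_eq if_True)
        have "y (- int (N * m) + int p) = code x (i + int p)"
          using x(2) p(2) unfolding k word_eq_iff by blast
        moreover have "- int (N * m) + int p = n" "i + int p = n + (i + int (N * m))"
          using p(1) by linarith+
        ultimately show ?thesis
          by (simp only: x'_def code_shift_by[OF x(1)])
      qed
      moreover have "x' \<in> X"
        unfolding x'_def using shift_X x(1) by (rule shift_by_mem)
      ultimately show ?thesis by blast
    qed
    then obtain x where x: "x \<in> X" "\<And>i. code x i = y i"
      using exists_point_with_code by blast
    then have "x \<in> ?F" using fixed_iff y by simp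
    moreover have "w = ?h x" using wy x(2) by (simp add: word_def)
    ultimately show "w \<in> ?h ` ?F" by blast
  qed
qed

text \<open>Composing the cover \<open>g\<close> with the recoding gives a local code on a shift of
  finite type, and \<open>lang\<close> is the language of its image.\<close>

lemma finite_followers:
  assumes Y: "shift_of_finite_type B Y" and g: "factor_map B Y A X g"
  shows "finite (range (follower lang))"
proof -
  have gY: "g ` Y = X" "\<And>y. y \<in> Y \<Longrightarrow> g (shift y) = shift (g y)"
    and gc: "continuous_map (shift_topology B Y) (shift_topology A X) g"
    using g by (auto simp: factor_map_def)
  have B: "finite B" using Y by (simp add: shift_of_finite_type_def)
  have "\<exists>R :: nat. \<forall>y\<in>Y. \<forall>z\<in>Y. (\<forall>i. \<bar>i\<bar> \<le> int R \<longrightarrow> y i = z i) \<longrightarrow> (\<psi> ^^ j) (g y) 0 = (\<psi> ^^ j) (g z) 0" for j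
  proof -
    have "continuous_map (shift_topology B Y) (discrete_topology A) (\<lambda>y. (\<psi> ^^ j) (g y) 0)"
      using continuous_map_compose[OF continuous_map_compose[OF gc continuous_funpow]
          continuous_map_from_subtopology[OF continuous_map_coordinate]]
      by (simp add: comp_def)
    then show ?thesis
      using local_rule[OF B shift_of_finite_type_closed[OF Y]] by metis
  qed
  then obtain \<rho> :: "nat \<Rightarrow> nat" where \<rho>: "\<And>j y z. y \<in> Y \<Longrightarrow> z \<in> Y \<Longrightarrow>
      (\<forall>i. \<bar>i\<bar> \<le> int (\<rho> j) \<longrightarrow> y i = z i) \<Longrightarrow> (\<psi> ^^ j) (g y) 0 = (\<psi> ^^ j) (g z) 0"
    by metis
  \<comment> \<open>One radius for all \<open>r\<close> entries of the letter at the origin.\<close>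
  define R where "R = Max (insert 0 (\<rho> ` {..<r}))"
  have R: "\<rho> j \<le> R" if "j < r" for j
    using that by (auto simp: R_def)
  define e where "e = (\<lambda>y. code (g y) 0)"
  have e_local: "e y = e z" if "y \<in> Y" "z \<in> Y" "\<And>i. \<bar>i\<bar> \<le> int R \<Longrightarrow> y i = z i" for y z
    unfolding e_def code_def
  proof (rule map_cong[OF refl])
    fix j assume "j \<in> set [0..<r]"
    then have "int (\<rho> j) \<le> int R" using R by simp
    then have "\<bar>i\<bar> \<le> int (\<rho> j) \<longrightarrow> y i = z i" for i
      using that(3)[of i] by linarith
    then show "(\<psi> ^^ j) (g y) 0 = (\<psi> ^^ j) (g z) 0"
      using \<rho>[OF that(1,2)] by blast
  qed
  \<comment> \<open>As \<open>g\<close> commutes with all translations, the rule \<open>e\<close>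
    read at the origin gives the code at every place.\<close>
  have cg: "(\<lambda>i. e (shift_by i y)) = code (g y)" if "y \<in> Y" for y
  proof
    fix i
    have "g (shift_by i y) = shift_by i (g y)"
      using shift_of_finite_type_shift_invariant[OF Y] that gY(2) by (rule shift_by_commute)
    then show "e (shift_by i y) = code (g y) i"
      using gY(1) that by (auto simp: e_def code_shift_by)
  qed
  then have "{word (\<lambda>i. e (shift_by i y)) j k | y j k. y \<in> Y} = lang"
  proof (intro equalityI subsetI)
    fix u assume "u \<in> {word (\<lambda>i. e (shift_by i y)) j k | y j k. y \<in> Y}"
    then obtain y j k where "y \<in> Y" "u = word (\<lambda>i. e (shift_by i y)) j k" by blast
    with cg word_in_lang[of "g y"] gY(1) show "u \<in> lang" by auto
  next
    fix u assume "u \<in> lang"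
    then obtain y j k where y: "y \<in> Y" "u = word (code (g y)) j k"
      using gY(1) unfolding lang_def by blast
    then have "u = word (\<lambda>i. e (shift_by i y)) j k"
      by (simp only: cg[OF y(1)])
    with y(1) show "u \<in> {word (\<lambda>i. e (shift_by i y)) j k | y j k. y \<in> Y}" by blast
  qed
  with finite_followers_of_local_code[where e = e and R = R, OF Y e_local] show ?thesis
    by (simp only:)
qed

end

section \<open>From the reversal to the trace formula\<close>

text \<open>A reversal satisfies \<open>shift (\<phi> (shift y)) = \<phi> y\<close> on
  \<open>X\<close>. Using this at \<open>\<phi> (shift x)\<close> and then at \<open>x\<close> moves
  the shift past both copies of \<open>\<phi>\<close>.\<close>

lemma reversal_square_commute:
  assumes X: "shift ` X = X" and \<phi>: "reversal A X \<phi>" and XA: "X \<subseteq> topspace (config_topology A)"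
    and x: "x \<in> X"
  shows "\<phi> (\<phi> (shift x)) = shift (\<phi> (\<phi> x))"
proof -
  have inj: "inj (shift :: (int \<Rightarrow> 'a) \<Rightarrow> _)"
    by (rule inj_on_inverseI[where g = "shift_by (- 1)"]) (simp add: shift_eq_shift_by)
  have rev: "shift (\<phi> (shift y)) = \<phi> y" if "y \<in> X" for y
    using \<phi> that X inj by (auto simp: reversal_def) (metis X image_eqI inj_on_subset inv_into_f_f subset_UNIV)
  have mem: "\<phi> y \<in> X" if "y \<in> X" for y
    using homeomorphic_imp_continuous_map continuous_map_image_subset_topspace \<phi> that XA
    unfolding reversal_def by fastforce
  have "\<phi> (shift x) \<in> X" using mem x X by blast
  from rev[OF this] have "shift (\<phi> (shift (\<phi> (shift x)))) = \<phi> (\<phi> (shift x))" .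
  with rev[OF x] show ?thesis by simp
qed

text \<open>The finiteness clause excludes the default value 0 of \<open>card\<close> on infinite
  sets, and \<open>d k \<ge> 1\<close> excludes empty matrices.\<close>

theorem theoremC:
  fixes A :: "'a set" and X :: "(int \<Rightarrow> 'a) set"
    and \<phi> :: "(int \<Rightarrow> 'a) \<Rightarrow> (int \<Rightarrow> 'a)" and r :: nat
  assumes "r \<ge> 1"
    and "sofic_shift_reversal_system A X \<phi>"
    and "has_order X \<phi> (2 * r)"
  shows "\<exists>(n :: nat) (d :: nat \<Rightarrow> nat) (M :: nat \<Rightarrow> int mat) (J :: nat \<Rightarrow> int mat).
    n \<ge> 1 \<and>
    (\<forall>k \<in> {1..n}. d k \<ge> 1 \<and> M k \<in> carrier_mat (d k) (d k) \<and> J k \<in> carrier_mat (d k) (d k)) \<and>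
    (\<forall>m l :: nat. m \<ge> 1 \<longrightarrow> l < r \<longrightarrow>
       finite (fixed_points X \<phi> m (2 * l)) \<and>
       int (card (fixed_points X \<phi> m (2 * l))) =
         (\<Sum>k = 1..n. (-1) ^ (k + 1) * trace_mat (M k ^\<^sub>m m * J k ^\<^sub>m (2 * l))))"
proof -
  obtain B :: "nat set" and Y g where sys: "shift_space A X" "reversal A X \<phi>"
    and Y: "shift_of_finite_type B Y" and g: "factor_map B Y A X g"
    using assms(2) by (auto simp: sofic_shift_reversal_system_def sofic_shift_def)
  have X: "finite A" "closedin (config_topology A) X" "shift ` X = X"
    using sys(1) by (auto simp: shift_space_def)
  have cont: "continuous_map (shift_topology A X) (shift_topology A X) \<phi>"
    using sys(2) homeomorphic_imp_continuous_map by (auto simp: reversal_def)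
  interpret finite_order_automorphism A X "\<phi> ^^ 2" r
  proof
    show "continuous_map (shift_topology A X) (shift_topology A X) (\<phi> ^^ 2)"
      using continuous_map_compose[OF cont cont] by (simp add: numeral_2_eq_2 comp_def)
    show "(\<phi> ^^ 2) (shift x) = shift ((\<phi> ^^ 2) x)" if "x \<in> X" for x
      using reversal_square_commute[OF X(3) sys(2) closedin_subset[OF X(2)] that]
      by (simp add: numeral_2_eq_2)
    show "((\<phi> ^^ 2) ^^ r) x = x" if "x \<in> X" for x
      using assms(3) that by (simp add: has_order_def funpow_mult)
  qed (use X assms(1) in auto)
  have fixed: "fixed_points X \<phi> m (2 * l) = {x \<in> X. shift_by (int m) (((\<phi> ^^ 2) ^^ l) x) = x}" for m l
    by (simp add: fixed_points_def funpow_shift funpow_mult)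
  have factorial: "\<forall>u v. u @ v \<in> lang \<longrightarrow> u \<in> lang \<and> v \<in> lang"
    using lang_factorial by (intro allI impI)
  have rotate1_in_lang: "map rotate1 w \<in> lang \<longleftrightarrow> w \<in> lang" for w
    using map_rotate_in_lang[of 1 w] by (simp add: rotate_def)
  from card_twisted_words[OF finite_letters finite_followers[OF Y g] factorial surj_rotate1 rotate1_in_lang]
  obtain d M J M' J' where d: "d \<ge> 1" "{M, J, M', J'} \<subseteq> carrier_mat d d"
    and tr: "\<forall>m\<ge>1. \<forall>l. int (card {w \<in> words letters m. \<forall>n. twisted_rep (rotate1 ^^ l) w n \<in> lang}) =
      trace_mat (M ^\<^sub>m m * J ^\<^sub>m (2 * l)) - trace_mat (M' ^\<^sub>m m * J' ^\<^sub>m (2 * l))"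
    by (elim exE conjE)
  \<comment> \<open>Two terms suffice: index 1, with sign +1, carries the odd exterior powers and
    index 2, with sign -1, the even ones.\<close>
  define M2 J2 where M2: "M2 = (\<lambda>k :: nat. if k = 1 then M else M')"
    and J2: "J2 = (\<lambda>k :: nat. if k = 1 then J else J')"
  have "finite (fixed_points X \<phi> m (2 * l)) \<and> int (card (fixed_points X \<phi> m (2 * l))) =
      (\<Sum>k = 1..2. (-1) ^ (k + 1) * trace_mat (M2 k ^\<^sub>m m * J2 k ^\<^sub>m (2 * l)))" if m: "m \<ge> 1" for m l
  proof -
    let ?W = "{w \<in> words letters m. \<forall>n. twisted_rep (rotate l) w n \<in> lang}"
    have W: "finite ?W" "int (card ?W) = trace_mat (M ^\<^sub>m m * J ^\<^sub>m (2 * l)) - trace_mat (M' ^\<^sub>m m * J' ^\<^sub>m (2 * l))"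
      using finite_letters tr m by (simp_all add: rotate_def)
    have sum: "(\<Sum>k = 1..2. (-1) ^ (k + 1) * trace_mat (M2 k ^\<^sub>m m * J2 k ^\<^sub>m (2 * l))) =
        trace_mat (M ^\<^sub>m m * J ^\<^sub>m (2 * l)) - trace_mat (M' ^\<^sub>m m * J' ^\<^sub>m (2 * l))"
      by (simp add: numeral_2_eq_2 M2 J2)
    show ?thesis
      unfolding fixed sum W(2)[symmetric]
      using bij_betw_finite[OF fixed_points_bij[OF m]] bij_betw_same_card[OF fixed_points_bij[OF m]] W(1)
      by simp
  qed
  with d show ?thesis
    by (intro exI[of _ 2] exI[of _ "\<lambda>_. d"] exI[of _ M2] exI[of _ J2]) (simp add: M2 J2)
qed

end
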